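(* Let $(\lambda_j)_{j\ge 1}$ be a sequence in $\mathbb{D}$ with $\sum_{j=1}^\infty (1-|\lambda_j|)=\infty$, let $B_n=\prod_{j=1}^{n}\left(-\frac{|\lambda_j|}{\lambda_j}b_{\lambda_j}\right)$ for $n\ge 1$, let $\psi\in C(\mathbb{T})$ and let $p\in\mathbb{N}$. Then $$\operatorname{Tr}\left( T_{B_n}\left[\frac{1}{|B_n'|}\right](T_{B_n}[\psi])^p\right)\to \int_{\mathbb{T}} \psi^p\, dm\qquad (n\to\infty).$$ If moreover $\psi$ is real-valued, then for every continuous function $g$ on $[\inf\psi,\sup\psi]$ we have $$\operatorname{Tr}\left( T_{B_n}\left[\frac{1}{|B_n'|}\right]g(T_{B_n}[\psi])\right)\to \int_{\mathbb{T}} g\circ\psi\, dm\qquad (n\to\infty).$$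
   Context: $\mathbb{D}$ is the open unit disc, $\mathbb{T}$ the unit circle, $m$ normalized Lebesgue measure on $\mathbb{T}$, $H^2$ the Hardy space viewed as a subspace of $L^2=L^2(\mathbb{T},m)$. For $a\in\mathbb{D}$, $b_a(z)=\frac{z-a}{1-\bar a z}$. In the definition of $B_n$, if $\lambda_j=0$ the corresponding factor is by convention $-b_0(z)=-z$. For an inner function $B$, the model space is $K_B=H^2\ominus BH^2$, $P_B$ is the orthogonal projection of $L^2$ onto $K_B$, and for a bounded function $\phi$ on $\mathbb{T}$ the truncated Toeplitz operator with symbol $\phi$ is $T_B[\phi]:K_B\to K_B$, $T_B[\phi]f=P_B(\phi f)$. In the symbol $1/|B_n'|$, $|B_n'|$ denotes the function $\zeta\mapsto |B_n'(\zeta)|$ on $\mathbb{T}$ (which is continuous and strictly positive). If $\psi$ is real-valued, $T_{B_n}[\psi]$ is self-adjoint with spectrum in $[\inf\psi,\sup\psi]$ and $g(T_{B_n}[\psi])$ is defined by the functional calculus. *)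

theory Defs
  imports "HOL-Complex_Analysis.Complex_Analysis"
begin

text \<open>
  Normalized Lebesgue measure on the unit circle. Its \<open>space\<close> is the circle itself, so values of
  functions \<^typ>\<open>complex \<Rightarrow> complex\<close> off the circle are irrelevant for measurability and integrals.
\<close>

definition circle_measure :: "complex measure" where
  "circle_measure =
     distr (uniform_measure lborel {0..2 * pi}) (restrict_space borel (sphere 0 1)) cis"

text \<open>
  Elements of \<open>L\<^sup>2\<close> are represented by functions, not by classes modulo almost everywhere equality.
  The subspaces below are closed under almost everywhere equality, and vectors are only ever
  compared almost everywhere or through the inner product.
\<close>

definition L2 :: "(complex \<Rightarrow> complex) set" where
  "L2 = {f \<in> borel_measurable circle_measure. integrable circle_measure (\<lambda>z. (norm (f z))\<^sup>2)}"

definition L2_inner :: "(complex \<Rightarrow> complex) \<Rightarrow> (complex \<Rightarrow> complex) \<Rightarrow> complex" where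
  "L2_inner f g = (\<integral>z. f z * cnj (g z) \<partial>circle_measure)"

definition L2_orthonormal_basis :: "(complex \<Rightarrow> complex) set \<Rightarrow> (complex \<Rightarrow> complex) set \<Rightarrow> bool" where
  "L2_orthonormal_basis K E \<longleftrightarrow>
     finite E \<and> E \<subseteq> K \<and>
     (\<forall>e\<in>E. \<forall>e'\<in>E. L2_inner e e' = (if e = e' then 1 else 0)) \<and>
     (\<forall>f\<in>K. AE z in circle_measure. f z = (\<Sum>e\<in>E. L2_inner f e * e z))"

text \<open>
  Orthogonal projection onto a closed subspace \<open>K\<close>. The result is determined up to almost
  everywhere equality, and \<open>L2_proj K f\<close> depends only on the class of \<open>f\<close>.
\<close>

definition L2_proj :: "(complex \<Rightarrow> complex) set \<Rightarrow> (complex \<Rightarrow> complex) \<Rightarrow> complex \<Rightarrow> complex" where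
  "L2_proj K f = (SOME g. g \<in> K \<and> (\<forall>k\<in>K. L2_inner (\<lambda>z. f z - g z) k = 0))"

text \<open>Trace of an operator on a finite-dimensional subspace \<open>K\<close>.\<close>

definition L2_trace ::
    "(complex \<Rightarrow> complex) set \<Rightarrow> ((complex \<Rightarrow> complex) \<Rightarrow> complex \<Rightarrow> complex) \<Rightarrow> complex" where
  "L2_trace K T = (let E = (SOME E. L2_orthonormal_basis K E) in \<Sum>e\<in>E. L2_inner (T e) e)"

definition L2_eigenspace ::
    "(complex \<Rightarrow> complex) set \<Rightarrow> ((complex \<Rightarrow> complex) \<Rightarrow> complex \<Rightarrow> complex) \<Rightarrow> complex
      \<Rightarrow> (complex \<Rightarrow> complex) set" where
  "L2_eigenspace K T \<mu> = {f \<in> K. AE z in circle_measure. T f z = \<mu> * f z}"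

text \<open>
  Real spectrum of an operator on a finite-dimensional subspace, i.e. its real eigenvalues.
  For a self-adjoint operator this is the whole spectrum.
\<close>

definition L2_spectrum ::
    "(complex \<Rightarrow> complex) set \<Rightarrow> ((complex \<Rightarrow> complex) \<Rightarrow> complex \<Rightarrow> complex) \<Rightarrow> real set" where
  "L2_spectrum K T =
     {\<mu>. \<exists>f \<in> L2_eigenspace K T (of_real \<mu>). \<not> (AE z in circle_measure. f z = 0)}"

text \<open>
  Functional calculus of a self-adjoint operator \<open>T\<close> on a finite-dimensional subspace \<open>K\<close>:
  \<open>g(T)\<close> is the sum of \<open>g(\<mu>) P\<^sub>\<mu>\<close> over the spectrum, where \<open>P\<^sub>\<mu>\<close> is the spectral projection,
  i.e. the orthogonal projection onto the eigenspace of \<open>\<mu>\<close>.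
\<close>

definition L2_fun_calc ::
    "(complex \<Rightarrow> complex) set \<Rightarrow> ((complex \<Rightarrow> complex) \<Rightarrow> complex \<Rightarrow> complex)
      \<Rightarrow> (real \<Rightarrow> complex) \<Rightarrow> (complex \<Rightarrow> complex) \<Rightarrow> complex \<Rightarrow> complex" where
  "L2_fun_calc K T g f =
     (\<lambda>z. \<Sum>\<mu>\<in>L2_spectrum K T. g \<mu> * L2_proj (L2_eigenspace K T (of_real \<mu>)) f z)"

text \<open>
  The Hardy space as a subspace of \<open>L\<^sup>2\<close>: all Fourier coefficients of negative index vanish
  (on the circle, \<open>z ^ k\<close> is the conjugate of the character of index \<open>-k\<close>).
\<close>

definition hardy2 :: "(complex \<Rightarrow> complex) set" where
  "hardy2 = {f \<in> L2. \<forall>k::nat. k \<ge> 1 \<longrightarrow> (\<integral>z. f z * z ^ k \<partial>circle_measure) = 0}"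

definition model_space :: "(complex \<Rightarrow> complex) \<Rightarrow> (complex \<Rightarrow> complex) set" where
  "model_space B = {f \<in> hardy2. \<forall>h\<in>hardy2. L2_inner f (\<lambda>z. B z * h z) = 0}"

definition trunc_toeplitz ::
    "(complex \<Rightarrow> complex) \<Rightarrow> (complex \<Rightarrow> complex) \<Rightarrow> (complex \<Rightarrow> complex) \<Rightarrow> complex \<Rightarrow> complex" where
  "trunc_toeplitz B \<phi> f = L2_proj (model_space B) (\<lambda>z. \<phi> z * f z)"

definition blaschke_factor :: "complex \<Rightarrow> complex \<Rightarrow> complex" where
  "blaschke_factor a z = (z - a) / (1 - cnj a * z)"

definition blaschke_prod :: "(nat \<Rightarrow> complex) \<Rightarrow> nat \<Rightarrow> complex \<Rightarrow> complex" where
  "blaschke_prod l n z =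
     (\<Prod>j=1..n. if l j = 0 then - blaschke_factor 0 z
                else - (of_real (norm (l j)) / l j) * blaschke_factor (l j) z)"

end

theory Submission
  imports Defs "HOL-Computational_Algebra.Fundamental_Theorem_Algebra"
begin

text \<open>
  Let \<open>k\<^sub>\<zeta>\<close> be the reproducing kernel of the model space \<open>K\<close> of \<open>B\<^sub>n\<close> at a point \<open>\<zeta>\<close> of the circle.
  The elements of \<open>K\<close> are rational functions without poles on the circle, so evaluation at \<open>\<zeta>\<close>
  makes sense, and \<open>\<parallel>k\<^sub>\<zeta>\<parallel>\<^sup>2 = \<bar>B\<^sub>n'(\<zeta>)\<bar>\<close>. Expanding an operator \<open>A\<close> on \<open>K\<close> in an orthonormal
  basis gives \<open>trace_compression_comp\<close>: the trace of \<open>T[w] A\<close> is the integral of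
  \<open>w(\<zeta>) \<langle>A k\<^sub>\<zeta>, k\<^sub>\<zeta>\<rangle>\<close>. For \<open>w = 1 / \<bar>B\<^sub>n'\<bar>\<close> it is therefore the average of \<open>\<langle>A \<kappa>\<^sub>\<zeta>, \<kappa>\<^sub>\<zeta>\<rangle>\<close>
  over the circle, where \<open>\<kappa>\<^sub>\<zeta>\<close> is the normalized kernel, and it suffices that this
  quantity converges uniformly in \<open>\<zeta>\<close> to \<open>\<psi>(\<zeta>)\<^sup>p\<close>, respectively to \<open>g(\<psi>(\<zeta>))\<close>
  (\<open>tendsto_trace_if_kern_approx\<close>).

  The reason for convergence is that the \<open>\<kappa>\<^sub>\<zeta>\<close> are an approximate identity. Indeed
  \<open>\<bar>k\<^sub>\<zeta>(z)\<bar> \<le> 2 / \<bar>z - \<zeta>\<bar>\<close> by the explicit formula for the kernel, while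
  \<open>\<bar>B\<^sub>n'(\<zeta>)\<bar> \<ge> \<Sum>\<^sub>j\<^sub>\<le>\<^sub>n (1 - \<bar>\<lambda>\<^sub>j\<bar>) / 2\<close>, which tends to infinity. Hence
  \<open>\<parallel>(\<psi> - \<psi>(\<zeta>)) \<kappa>\<^sub>\<zeta>\<parallel>\<close> tends to \<open>0\<close> uniformly in \<open>\<zeta>\<close> (\<open>kern_concentrates\<close>), that is, \<open>\<kappa>\<^sub>\<zeta>\<close> is nearly
  an eigenvector of \<open>T[\<psi>]\<close> for \<open>\<psi>(\<zeta>)\<close>. For powers the claim follows by induction on \<open>p\<close>
  (\<open>compression_funpow_approx\<close>); for real \<open>\<psi>\<close> the spectral measure of \<open>\<kappa>\<^sub>\<zeta>\<close> is
  concentrated near \<open>\<psi>(\<zeta>)\<close>, whence the claim for continuous \<open>g\<close> (\<open>fun_calc_approx\<close>).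

  The facts about model spaces come from the Takenaka--Malmquist functions, which are shown to be
  an orthonormal basis by peeling off one Blaschke factor at a time (\<open>e_basis\<close>). Everything in
  the Hardy space reduces to linear recurrences between Fourier coefficients. The spectral
  theorem for self-adjoint operators on a finite-dimensional subspace is
  \<open>orthonormal_eigenbasis\<close>.
\<close>

section \<open>The normalized measure of the circle\<close>

lemma cis_measurable_circle [measurable]:
  "cis \<in> uniform_measure lborel {0..2 * pi} \<rightarrow>\<^sub>M restrict_space borel (sphere 0 1)"
proof (rule measurable_restrict_space2)
  have "cis \<in> borel_measurable borel"
    by (intro borel_measurable_continuous_onI continuous_intros)
  then show "cis \<in> borel_measurable (uniform_measure lborel {0..2 * pi})"
    by simp
qed auto

lemma space_circle [simp]: "space circle_measure = sphere 0 1"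
  by (simp add: circle_measure_def space_restrict_space)

lemma sets_circle [measurable_cong]: "sets circle_measure = sets (restrict_space borel (sphere 0 1))"
  by (simp add: circle_measure_def)

lemma emeasure_circle: "emeasure circle_measure (sphere 0 1) = 1"
proof -
  have "emeasure circle_measure (space circle_measure)
      = emeasure (uniform_measure lborel {0..2 * pi}) (cis -` sphere 0 1 \<inter> UNIV)"
    unfolding space_circle unfolding circle_measure_def
    by (subst emeasure_distr) (auto simp: sets_restrict_space)
  also have "cis -` sphere 0 1 \<inter> UNIV = UNIV"
    by auto
  also have "emeasure (uniform_measure lborel {0..2 * pi}) UNIV = 1"
    by (subst emeasure_uniform_measure) (auto intro!: ennreal_divide_self)
  finally show ?thesis by simp
qed

lemma finite_measure_circle: "finite_measure circle_measure"
  by standard (simp add: emeasure_circle)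

interpretation circle: finite_measure circle_measure
  by (rule finite_measure_circle)

lemma measure_circle [simp]: "measure circle_measure (sphere 0 1) = 1"
  by (simp add: measure_def emeasure_circle)

lemma continuous_on_circle_measurable:
  "continuous_on (sphere 0 1) f \<Longrightarrow> f \<in> borel_measurable circle_measure"
  for f :: "complex \<Rightarrow> 'b::topological_space"
  by (subst measurable_cong_sets[OF sets_circle refl])
     (rule borel_measurable_continuous_on_restrict)

lemma integrable_circle_bounded:
  fixes f :: "complex \<Rightarrow> 'b::{banach, second_countable_topology}"
  assumes "f \<in> borel_measurable circle_measure" "\<And>z. norm z = 1 \<Longrightarrow> norm (f z) \<le> M"
  shows "integrable circle_measure f"
  using assms by (intro circle.integrable_const_bound[where B = M]) auto

lemma continuous_on_circle_bounded:
  fixes f :: "complex \<Rightarrow> 'b::real_normed_vector"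
  assumes "continuous_on (sphere 0 1) f"
  obtains M where "M \<ge> 1" "\<And>z. norm z = 1 \<Longrightarrow> norm (f z) \<le> M"
proof -
  have "compact (f ` sphere 0 1)"
    using assms by (intro compact_continuous_image) auto
  then obtain M where "\<And>x. x \<in> f ` sphere 0 1 \<Longrightarrow> norm x \<le> M"
    using compact_imp_bounded bounded_iff by metis
  then show thesis
    by (intro that[of "max 1 M"]) (auto simp: le_max_iff_disj)
qed

lemma integrable_circle_continuous:
  fixes f :: "complex \<Rightarrow> 'b::{banach, second_countable_topology}"
  assumes "continuous_on (sphere 0 1) f"
  shows "integrable circle_measure f"
  using continuous_on_circle_bounded[OF assms] continuous_on_circle_measurable[OF assms]
  by (metis integrable_circle_bounded)

lemma integral_circle_power:
  assumes "k \<ge> 1"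
  shows "(\<integral>z. z ^ k \<partial>circle_measure) = 0"
proof -
  have "(\<integral>z. z ^ k \<partial>circle_measure) = (\<integral>t. cis t ^ k \<partial>uniform_measure lborel {0..2 * pi})"
    unfolding circle_measure_def
    by (subst integral_distr) (auto intro!: measurable_restrict_space1 borel_measurable_continuous_onI continuous_intros)
  also have "\<dots> = (\<integral>t. (indicator {0..2*pi} t / (2*pi)) *\<^sub>R cis t ^ k \<partial>lborel)"
  proof -
    have "indicator {0..2 * pi} t / emeasure lborel {0..2*pi} = ennreal (indicator {0..2*pi} t / (2*pi))" for t :: real
      by (auto simp: indicator_def divide_ennreal simp flip: ennreal_1)
    moreover have "(\<lambda>t. cis t ^ k) \<in> borel_measurable lborel"
      by (auto intro!: borel_measurable_continuous_onI continuous_intros)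
    ultimately show ?thesis
      unfolding uniform_measure_def by (subst integral_density[symmetric]) auto
  qed
  also have "\<dots> = (\<integral>t. (1 / (2*pi)) *\<^sub>R (indicator {0..2*pi} t *\<^sub>R cis (real k * t)) \<partial>lborel)"
    by (intro Bochner_Integration.integral_cong refl) (simp add: Complex.DeMoivre)
  also have "\<dots> = (1 / (2*pi)) *\<^sub>R (\<integral>t. indicator {0..2*pi} t *\<^sub>R cis (real k * t) \<partial>lborel)"
    by (rule integral_scaleR_right)
  also have "(\<integral>t. indicator {0..2*pi} t *\<^sub>R cis (real k * t) \<partial>lborel)
      = cis (real k * (2 * pi)) / (\<i> * k) - cis (real k * 0) / (\<i> * k)"
  proof (rule integral_FTC_Icc)
    fix x :: real
    show "((\<lambda>x. cis (real k * x) / (\<i> * k)) has_vector_derivative cis (real k * x)) (at x within {0..2 * pi})"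
      using assms unfolding cis_conv_exp
      by (auto intro!: derivative_eq_intros has_vector_derivative_real_field simp: field_simps)
  qed (auto intro!: continuous_intros)
  also have "cis (real k * (2 * pi)) = 1"
    by (metis cis_multiple_2pi Ints_of_nat mult.commute mult.assoc)
  finally show ?thesis by simp
qed

section \<open>Square integrable functions on the circle\<close>

text \<open>
  The square root of \<open>\<langle>f, f\<rangle>\<close>; a genuine norm only after almost everywhere equal functions
  have been identified.
\<close>

definition L2_norm :: "(complex \<Rightarrow> complex) \<Rightarrow> real" where
  "L2_norm f = sqrt (\<integral>z. (norm (f z))\<^sup>2 \<partial>circle_measure)"

lemma L2_norm_nonneg [simp]: "L2_norm f \<ge> 0"
  by (simp add: L2_norm_def)

lemma L2_norm_sq: "(L2_norm f)\<^sup>2 = (\<integral>z. (norm (f z))\<^sup>2 \<partial>circle_measure)"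
  by (simp add: L2_norm_def)

lemma L2_measurable: "f \<in> L2 \<Longrightarrow> f \<in> borel_measurable circle_measure"
  by (simp add: L2_def)

lemma L2_sq_integrable: "f \<in> L2 \<Longrightarrow> integrable circle_measure (\<lambda>z. (norm (f z))\<^sup>2)"
  by (simp add: L2_def)

lemma L2_bounded:
  assumes "f \<in> borel_measurable circle_measure" "\<And>z. norm z = 1 \<Longrightarrow> norm (f z) \<le> M"
  shows "f \<in> L2"
  using assms unfolding L2_def
  by (auto intro!: integrable_circle_bounded[where M = "M\<^sup>2"] power_mono)

lemma L2_continuous: "continuous_on (sphere 0 1) f \<Longrightarrow> f \<in> L2"
  by (metis L2_bounded continuous_on_circle_bounded continuous_on_circle_measurable)

lemma L2_mult_bounded:
  assumes "f \<in> L2" "\<phi> \<in> borel_measurable circle_measure" "\<And>z. norm z = 1 \<Longrightarrow> norm (\<phi> z) \<le> M"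
  shows "(\<lambda>z. \<phi> z * f z) \<in> L2"
proof -
  have "integrable circle_measure (\<lambda>z. (norm (\<phi> z * f z))\<^sup>2)"
  proof (rule Bochner_Integration.integrable_bound)
    show "integrable circle_measure (\<lambda>z. M\<^sup>2 * (norm (f z))\<^sup>2)"
      using assms L2_sq_integrable by auto
    show "(\<lambda>z. (norm (\<phi> z * f z))\<^sup>2) \<in> borel_measurable circle_measure"
      using assms L2_measurable by measurable
    show "AE z in circle_measure. norm ((norm (\<phi> z * f z))\<^sup>2) \<le> norm (M\<^sup>2 * (norm (f z))\<^sup>2)"
      using assms(3) by (intro AE_I2) (auto simp: norm_mult power_mult_distrib intro!: mult_right_mono power_mono)
  qed
  moreover have "(\<lambda>z. \<phi> z * f z) \<in> borel_measurable circle_measure"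
    using assms(2) L2_measurable[OF assms(1)] by measurable
  ultimately show ?thesis
    by (simp add: L2_def)
qed

lemma L2_mult_continuous:
  assumes "f \<in> L2" "continuous_on (sphere 0 1) \<phi>"
  shows "(\<lambda>z. \<phi> z * f z) \<in> L2"
  by (metis assms L2_mult_bounded continuous_on_circle_bounded continuous_on_circle_measurable)

lemma L2_scale: "f \<in> L2 \<Longrightarrow> (\<lambda>z. c * f z) \<in> L2"
  by (auto intro: L2_mult_continuous)

lemma L2_add:
  assumes "f \<in> L2" "g \<in> L2"
  shows "(\<lambda>z. f z + g z) \<in> L2"
proof -
  have "integrable circle_measure (\<lambda>z. (norm (f z + g z))\<^sup>2)"
  proof (rule Bochner_Integration.integrable_bound)
    show "integrable circle_measure (\<lambda>z. 2 * (norm (f z))\<^sup>2 + 2 * (norm (g z))\<^sup>2)"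
      using assms L2_sq_integrable by auto
    show "(\<lambda>z. (norm (f z + g z))\<^sup>2) \<in> borel_measurable circle_measure"
      using assms L2_measurable by measurable
    have "(norm (a + b))\<^sup>2 \<le> 2 * (norm a)\<^sup>2 + 2 * (norm b)\<^sup>2" for a b :: complex
    proof -
      have "(norm (a + b))\<^sup>2 \<le> (norm a + norm b)\<^sup>2"
        by (intro power_mono norm_triangle_ineq) auto
      also have "\<dots> \<le> 2 * (norm a)\<^sup>2 + 2 * (norm b)\<^sup>2"
        using sum_squares_bound[of "norm a" "norm b"] by (simp add: power2_sum)
      finally show ?thesis .
    qed
    then show "AE z in circle_measure.
        norm ((norm (f z + g z))\<^sup>2) \<le> norm (2 * (norm (f z))\<^sup>2 + 2 * (norm (g z))\<^sup>2)"
      by (intro AE_I2) simp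
  qed
  moreover have "(\<lambda>z. f z + g z) \<in> borel_measurable circle_measure"
    using L2_measurable[OF assms(1)] L2_measurable[OF assms(2)] by measurable
  ultimately show ?thesis
    by (simp add: L2_def)
qed

lemma L2_zero: "(\<lambda>z. 0) \<in> L2"
  by (auto intro: L2_continuous)

lemma L2_diff: "f \<in> L2 \<Longrightarrow> g \<in> L2 \<Longrightarrow> (\<lambda>z. f z - g z) \<in> L2"
  using L2_add[of f "\<lambda>z. (-1) * g z"] L2_scale[of g "-1"] by simp

lemma L2_sum: "(\<And>i. i \<in> I \<Longrightarrow> f i \<in> L2) \<Longrightarrow> (\<lambda>z. \<Sum>i\<in>I. f i z) \<in> L2"
  by (induction I rule: infinite_finite_induct) (auto intro: L2_zero L2_add)

lemma borel_measurable_cnj [measurable]: "cnj \<in> borel_measurable borel"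
  by (intro borel_measurable_continuous_onI continuous_intros)

lemma L2_cnj: "f \<in> L2 \<Longrightarrow> (\<lambda>z. cnj (f z)) \<in> L2"
  using measurable_compose[OF _ borel_measurable_cnj, of f circle_measure] by (simp add: L2_def)

lemma L2_product_integrable:
  assumes "f \<in> L2" "g \<in> L2"
  shows "integrable circle_measure (\<lambda>z. f z * g z)"
proof (rule Bochner_Integration.integrable_bound)
  show "integrable circle_measure (\<lambda>z. (norm (f z))\<^sup>2 + (norm (g z))\<^sup>2)"
    using assms L2_sq_integrable by auto
  show "(\<lambda>z. f z * g z) \<in> borel_measurable circle_measure"
    using assms L2_measurable by measurable
  have "norm (f z) * norm (g z) \<le> (norm (f z))\<^sup>2 + (norm (g z))\<^sup>2" for z
    using sum_squares_bound[of "norm (f z)" "norm (g z)"] mult_nonneg_nonneg[OF norm_ge_zero norm_ge_zero, of "f z" "g z"]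
    unfolding mult.assoc by linarith
  then show "AE z in circle_measure. norm (f z * g z) \<le> norm ((norm (f z))\<^sup>2 + (norm (g z))\<^sup>2)"
    by (intro AE_I2) (simp add: norm_mult)
qed

lemma L2_integrable: "f \<in> L2 \<Longrightarrow> integrable circle_measure f"
  using L2_product_integrable[of f "\<lambda>z. 1"] L2_continuous[of "\<lambda>z. 1"] by auto

lemma L2_inner_integrable: "f \<in> L2 \<Longrightarrow> g \<in> L2 \<Longrightarrow> integrable circle_measure (\<lambda>z. f z * cnj (g z))"
  by (intro L2_product_integrable L2_cnj)

lemma L2_inner_commute: "L2_inner g f = cnj (L2_inner f g)"
  unfolding L2_inner_def
  by (subst Bochner_Integration.integral_cnj[symmetric]) (simp add: mult.commute)

lemma cnj_L2_inner [simp]: "cnj (L2_inner f g) = L2_inner g f"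
  by (rule L2_inner_commute[symmetric])

lemma L2_inner_scale_left: "L2_inner (\<lambda>z. c * f z) g = c * L2_inner f g"
  unfolding L2_inner_def by (simp add: mult.assoc)

lemma L2_inner_scale_right: "L2_inner f (\<lambda>z. c * g z) = cnj c * L2_inner f g"
  by (metis L2_inner_commute L2_inner_scale_left complex_cnj_mult)

lemma L2_inner_add_left:
  "f \<in> L2 \<Longrightarrow> g \<in> L2 \<Longrightarrow> h \<in> L2 \<Longrightarrow> L2_inner (\<lambda>z. f z + g z) h = L2_inner f h + L2_inner g h"
  unfolding L2_inner_def by (simp add: distrib_right L2_inner_integrable)

lemma L2_inner_diff_left:
  "f \<in> L2 \<Longrightarrow> g \<in> L2 \<Longrightarrow> h \<in> L2 \<Longrightarrow> L2_inner (\<lambda>z. f z - g z) h = L2_inner f h - L2_inner g h"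
  unfolding L2_inner_def by (simp add: left_diff_distrib L2_inner_integrable)

lemma L2_inner_sum_left:
  assumes "\<And>i. i \<in> I \<Longrightarrow> f i \<in> L2" "h \<in> L2"
  shows "L2_inner (\<lambda>z. \<Sum>i\<in>I. c i * f i z) h = (\<Sum>i\<in>I. c i * L2_inner (f i) h)"
proof -
  have "L2_inner (\<lambda>z. \<Sum>i\<in>I. c i * f i z) h = (\<integral>z. (\<Sum>i\<in>I. c i * (f i z * cnj (h z))) \<partial>circle_measure)"
    unfolding L2_inner_def by (simp add: sum_distrib_right mult.assoc)
  also have "\<dots> = (\<Sum>i\<in>I. (\<integral>z. c i * (f i z * cnj (h z)) \<partial>circle_measure))"
    using assms by (intro Bochner_Integration.integral_sum) (auto intro!: L2_inner_integrable)
  finally show ?thesis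
    unfolding L2_inner_def by simp
qed

lemma L2_inner_sum_right:
  assumes "\<And>i. i \<in> I \<Longrightarrow> f i \<in> L2" "h \<in> L2"
  shows "L2_inner h (\<lambda>z. \<Sum>i\<in>I. c i * f i z) = (\<Sum>i\<in>I. cnj (c i) * L2_inner h (f i))"
proof -
  have "L2_inner h (\<lambda>z. \<Sum>i\<in>I. c i * f i z) = cnj (\<Sum>i\<in>I. c i * L2_inner (f i) h)"
    by (subst L2_inner_commute, subst L2_inner_sum_left) (use assms in auto)
  also have "\<dots> = (\<Sum>i\<in>I. cnj (c i) * L2_inner h (f i))"
    by simp
  finally show ?thesis .
qed

lemma L2_inner_mult_left: "L2_inner (\<lambda>z. \<phi> z * f z) g = L2_inner f (\<lambda>z. cnj (\<phi> z) * g z)"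
  unfolding L2_inner_def by (simp add: mult_ac)

lemma L2_inner_cong:
  assumes "AE z in circle_measure. f z = f' z" "f \<in> L2" "f' \<in> L2" "g \<in> L2"
  shows "L2_inner f g = L2_inner f' g"
  unfolding L2_inner_def
  using assms(1) L2_measurable[OF assms(2)] L2_measurable[OF assms(3)] L2_measurable[OF assms(4)]
  by (intro integral_cong_AE) auto

lemma L2_inner_self: "L2_inner f f = of_real ((L2_norm f)\<^sup>2)"
  unfolding L2_inner_def L2_norm_sq
  by (subst integral_complex_of_real[symmetric]) (simp add: complex_norm_square[symmetric] del: of_real_power)

lemma L2_norm_eq_0:
  assumes "f \<in> L2"
  shows "L2_norm f = 0 \<longleftrightarrow> (AE z in circle_measure. f z = 0)"
proof -
  have "L2_norm f = 0 \<longleftrightarrow> (\<integral>z. (norm (f z))\<^sup>2 \<partial>circle_measure) = 0"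
    by (simp add: L2_norm_def)
  also have "\<dots> \<longleftrightarrow> (AE z in circle_measure. (norm (f z))\<^sup>2 = 0)"
    using assms L2_sq_integrable by (intro integral_nonneg_eq_0_iff_AE) auto
  finally show ?thesis by simp
qed

lemma L2_Cauchy_Schwarz:
  assumes "f \<in> L2" "g \<in> L2"
  shows "norm (L2_inner f g) \<le> L2_norm f * L2_norm g"
proof (cases "L2_norm g = 0")
  case True
  have "L2_inner g f = L2_inner (\<lambda>z. 0) f"
    using True assms L2_zero L2_norm_eq_0 by (intro L2_inner_cong) auto
  then have "L2_inner f g = 0"
    by (subst L2_inner_commute) (simp add: L2_inner_def)
  then show ?thesis by simp
next
  case False
  let ?N = "(L2_norm g)\<^sup>2" and ?a = "L2_inner f g"
  \<comment> \<open>a multiple of the component of \<open>f\<close> orthogonal to \<open>g\<close>\<close>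
  let ?h = "\<lambda>z. ?N * f z - ?a * g z"
  have mem: "?h \<in> L2" "(\<lambda>z. ?N * f z) \<in> L2" "(\<lambda>z. ?a * g z) \<in> L2"
    using assms by (auto intro: L2_diff L2_scale)
  have *: "L2_inner ?h g = 0"
    using assms mem by (simp add: L2_inner_diff_left L2_inner_scale_left L2_inner_self)
  have "L2_inner ?h ?h = ?N * L2_inner f ?h - ?a * L2_inner g ?h"
    using L2_inner_diff_left[OF mem(2,3,1)] by (simp only: L2_inner_scale_left)
  also have "L2_inner g ?h = 0"
    using * by (subst L2_inner_commute) simp
  also have "L2_inner f ?h = cnj (L2_inner ?h f)"
    by (rule L2_inner_commute)
  also have "L2_inner ?h f = ?N * L2_inner f f - ?a * L2_inner g f"
    using L2_inner_diff_left[OF mem(2,3) assms(1)] by (simp only: L2_inner_scale_left)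
  finally have "L2_inner ?h ?h = ?N * (?N * (L2_norm f)\<^sup>2 - ?a * cnj ?a)"
    by (simp add: L2_inner_self mult.commute)
  then have "complex_of_real ((L2_norm ?h)\<^sup>2) = of_real (?N * (?N * (L2_norm f)\<^sup>2 - (norm ?a)\<^sup>2))"
    unfolding L2_inner_self by (simp add: complex_norm_square del: of_real_power cnj_L2_inner)
  then have "(L2_norm ?h)\<^sup>2 = ?N * (?N * (L2_norm f)\<^sup>2 - (norm ?a)\<^sup>2)"
    using of_real_eq_iff by blast
  then have "?N * (?N * (L2_norm f)\<^sup>2 - (norm ?a)\<^sup>2) \<ge> 0"
    by (metis zero_le_power2)
  moreover have "?N > 0"
    using False by simp
  ultimately have "(norm ?a)\<^sup>2 \<le> (L2_norm f * L2_norm g)\<^sup>2"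
    by (simp add: zero_le_mult_iff power_mult_distrib mult.commute)
  then show ?thesis
    by (rule power2_le_imp_le) simp
qed

lemma L2_norm_mult_le:
  assumes "f \<in> L2" "\<phi> \<in> borel_measurable circle_measure" "\<And>z. norm z = 1 \<Longrightarrow> norm (\<phi> z) \<le> M"
  shows "L2_norm (\<lambda>z. \<phi> z * f z) \<le> M * L2_norm f"
proof -
  have M: "M \<ge> 0"
    using assms(3)[of 1] by (metis norm_ge_zero norm_one order_trans)
  have "(\<integral>z. (norm (\<phi> z * f z))\<^sup>2 \<partial>circle_measure) \<le> (\<integral>z. M\<^sup>2 * (norm (f z))\<^sup>2 \<partial>circle_measure)"
  proof (rule integral_mono)
    show "integrable circle_measure (\<lambda>z. (norm (\<phi> z * f z))\<^sup>2)"
      using L2_sq_integrable[OF L2_mult_bounded[OF assms]] by simp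
    show "integrable circle_measure (\<lambda>z. M\<^sup>2 * (norm (f z))\<^sup>2)"
      using L2_sq_integrable[OF assms(1)] by simp
    show "(norm (\<phi> z * f z))\<^sup>2 \<le> M\<^sup>2 * (norm (f z))\<^sup>2" if "z \<in> space circle_measure" for z
      using assms(3)[of z] that unfolding norm_mult power_mult_distrib
      by (intro mult_right_mono power_mono) auto
  qed
  then have "(L2_norm (\<lambda>z. \<phi> z * f z))\<^sup>2 \<le> (M * L2_norm f)\<^sup>2"
    by (simp add: L2_norm_sq power_mult_distrib)
  then show ?thesis
    by (rule power2_le_imp_le) (simp add: M)
qed

section \<open>Finite-dimensional subspaces of the square integrable functions\<close>

lemma le_if_power2_le_mult:
  fixes a b :: real
  assumes "a\<^sup>2 \<le> b * a" "a \<ge> 0" "b \<ge> 0"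
  shows "a \<le> b"
  using assms by (cases "a = 0") (auto simp: power2_eq_square)

lemma L2_Bessel:
  assumes E: "finite E" "E \<subseteq> L2"
    and on: "\<And>e e'. e \<in> E \<Longrightarrow> e' \<in> E \<Longrightarrow> L2_inner e e' = (if e = e' then 1 else 0)"
    and f: "f \<in> L2"
  shows "(\<Sum>e\<in>E. (norm (L2_inner f e))\<^sup>2) \<le> (L2_norm f)\<^sup>2"
proof -
  let ?g = "\<lambda>z. \<Sum>e\<in>E. L2_inner f e * e z"
  let ?S = "\<Sum>e\<in>E. (norm (L2_inner f e))\<^sup>2"
  have g: "?g \<in> L2"
    using E by (auto intro!: L2_sum L2_scale)
  have fg: "L2_inner f ?g = of_real ?S"
    using E f by (subst L2_inner_sum_right) (auto simp: complex_norm_square mult.commute simp del: of_real_power)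
  have "L2_inner ?g ?g = (\<Sum>e\<in>E. L2_inner f e * L2_inner e ?g)"
    using E g by (intro L2_inner_sum_left) auto
  also have "\<dots> = (\<Sum>e\<in>E. L2_inner f e * cnj (L2_inner f e))"
  proof (intro sum.cong refl)
    fix e assume e: "e \<in> E"
    have "L2_inner e ?g = (\<Sum>e'\<in>E. cnj (L2_inner f e') * L2_inner e e')"
      using E e by (intro L2_inner_sum_right) auto
    also have "\<dots> = (\<Sum>e'\<in>E. if e = e' then cnj (L2_inner f e') else 0)"
      using e on by (intro sum.cong) auto
    also have "\<dots> = cnj (L2_inner f e)"
      using E e by simp
    finally show "L2_inner f e * L2_inner e ?g = L2_inner f e * cnj (L2_inner f e)"
      by simp
  qed
  also have "\<dots> = of_real ?S"
    by (simp add: complex_norm_square del: of_real_power)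
  finally have gg: "L2_inner ?g ?g = of_real ?S" .
  have "?S \<le> L2_norm f * L2_norm ?g"
    using L2_Cauchy_Schwarz[OF f g] unfolding fg norm_of_real by linarith
  moreover have S: "?S \<ge> 0" "?S = (L2_norm ?g)\<^sup>2"
    using gg unfolding L2_inner_self of_real_eq_iff by (auto simp: sum_nonneg)
  ultimately have le: "(L2_norm ?g)\<^sup>2 \<le> L2_norm f * L2_norm ?g"
    by simp
  have "L2_norm ?g \<le> L2_norm f"
    by (rule le_if_power2_le_mult[OF le]) auto
  then show ?thesis
    unfolding S(2) by (intro power_mono) auto
qed

text \<open>
  Functions are only identified up to almost everywhere equality, so an operator on \<open>K\<close> need not
  be linear pointwise. Having an adjoint is the convenient substitute: it forces linearity, and
  compatibility with almost everywhere equality, of all inner products with the values of \<open>A\<close>.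
\<close>

definition adjoint_on ::
    "(complex \<Rightarrow> complex) set \<Rightarrow> ((complex \<Rightarrow> complex) \<Rightarrow> complex \<Rightarrow> complex)
      \<Rightarrow> ((complex \<Rightarrow> complex) \<Rightarrow> complex \<Rightarrow> complex) \<Rightarrow> bool" where
  "adjoint_on K A A' \<longleftrightarrow>
     (\<forall>f\<in>K. A f \<in> K \<and> A' f \<in> K) \<and> (\<forall>f\<in>K. \<forall>k\<in>K. L2_inner (A f) k = L2_inner f (A' k))"

lemma adjoint_onD:
  assumes "adjoint_on K A A'"
  shows "f \<in> K \<Longrightarrow> A f \<in> K" "f \<in> K \<Longrightarrow> A' f \<in> K"
    "f \<in> K \<Longrightarrow> k \<in> K \<Longrightarrow> L2_inner (A f) k = L2_inner f (A' k)"
  using assms by (auto simp: adjoint_on_def)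

lemma adjoint_on_comp:
  assumes "adjoint_on K A A'" "adjoint_on K C C'"
  shows "adjoint_on K (A \<circ> C) (C' \<circ> A')"
  using assms by (auto simp: adjoint_on_def)

lemma adjoint_on_funpow:
  assumes "adjoint_on K A A'"
  shows "adjoint_on K (A ^^ p) (A' ^^ p)"
proof (induction p)
  case 0
  then show ?case by (simp add: adjoint_on_def)
next
  case (Suc p)
  have "adjoint_on K (A \<circ> A ^^ p) (A' ^^ p \<circ> A')"
    by (rule adjoint_on_comp[OF assms Suc])
  then show ?case
    by (simp add: funpow_swap1 comp_def)
qed

locale L2_subspace =
  fixes K E :: "(complex \<Rightarrow> complex) set"
  assumes K_L2: "K \<subseteq> L2"
    and K_zero: "(\<lambda>z. 0) \<in> K"
    and K_add: "\<And>f g. f \<in> K \<Longrightarrow> g \<in> K \<Longrightarrow> (\<lambda>z. f z + g z) \<in> K"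
    and K_scale: "\<And>f c. f \<in> K \<Longrightarrow> (\<lambda>z. c * f z) \<in> K"
    and basis: "L2_orthonormal_basis K E"
begin

lemma in_L2: "f \<in> K \<Longrightarrow> f \<in> L2"
  using K_L2 by auto

lemma finite_E: "finite E"
  and E_in_K: "e \<in> E \<Longrightarrow> e \<in> K"
  and E_orthonormal: "e \<in> E \<Longrightarrow> e' \<in> E \<Longrightarrow> L2_inner e e' = (if e = e' then 1 else 0)"
  and E_expansion: "f \<in> K \<Longrightarrow> AE z in circle_measure. f z = (\<Sum>e\<in>E. L2_inner f e * e z)"
  using basis by (auto simp: L2_orthonormal_basis_def)

lemma E_L2: "E \<subseteq> L2"
  using E_in_K in_L2 by auto

lemma K_sum: "(\<And>i. i \<in> I \<Longrightarrow> f i \<in> K) \<Longrightarrow> (\<lambda>z. \<Sum>i\<in>I. c i * f i z) \<in> K"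
  by (induction I rule: infinite_finite_induct) (auto intro!: K_zero K_add K_scale)

lemma Parseval:
  assumes "f \<in> K" "h \<in> L2"
  shows "L2_inner f h = (\<Sum>e\<in>E. L2_inner f e * L2_inner e h)"
proof -
  have "L2_inner f h = L2_inner (\<lambda>z. \<Sum>e\<in>E. L2_inner f e * e z) h"
    using E_expansion[OF assms(1)] by (intro L2_inner_cong in_L2 K_sum E_in_K assms)
  also have "\<dots> = (\<Sum>e\<in>E. L2_inner f e * L2_inner e h)"
    using assms in_L2 E_in_K by (intro L2_inner_sum_left) auto
  finally show ?thesis .
qed

lemma Parseval_norm:
  assumes "f \<in> K"
  shows "(L2_norm f)\<^sup>2 = (\<Sum>e\<in>E. (norm (L2_inner f e))\<^sup>2)"
proof -
  have "complex_of_real ((L2_norm f)\<^sup>2) = (\<Sum>e\<in>E. L2_inner f e * cnj (L2_inner f e))"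
    using Parseval[OF assms in_L2[OF assms]] by (simp add: L2_inner_self)
  also have "\<dots> = of_real (\<Sum>e\<in>E. (norm (L2_inner f e))\<^sup>2)"
    by (simp add: complex_norm_square del: of_real_power cnj_L2_inner)
  finally show ?thesis
    using of_real_eq_iff by blast
qed

lemma AE_eq_if_inner_eq:
  assumes "f \<in> K" "g \<in> K" "\<And>e. e \<in> E \<Longrightarrow> L2_inner f e = L2_inner g e"
  shows "AE z in circle_measure. f z = g z"
  using E_expansion[OF assms(1)] E_expansion[OF assms(2)] by eventually_elim (simp add: assms(3))

lemma L2_proj:
  assumes f: "f \<in> L2"
  shows L2_proj_in: "L2_proj K f \<in> K"
    and L2_inner_proj: "k \<in> K \<Longrightarrow> L2_inner (L2_proj K f) k = L2_inner f k"
proof -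
  let ?g = "\<lambda>z. \<Sum>e\<in>E. L2_inner f e * e z"
  have g: "?g \<in> K"
    using E_in_K by (intro K_sum)
  let ?P = "\<lambda>g. g \<in> K \<and> (\<forall>k\<in>K. L2_inner (\<lambda>z. f z - g z) k = 0)"
  have "L2_inner (\<lambda>z. f z - ?g z) k = 0" if k: "k \<in> K" for k
  proof -
    have "L2_inner ?g k = (\<Sum>e\<in>E. L2_inner f e * L2_inner e k)"
      using E_L2 in_L2 k by (intro L2_inner_sum_left) auto
    also have "\<dots> = cnj (\<Sum>e\<in>E. L2_inner k e * L2_inner e f)"
      by (simp add: mult.commute)
    also have "\<dots> = L2_inner f k"
      using Parseval[OF k f] by (metis cnj_L2_inner)
    finally show ?thesis
      using L2_inner_diff_left[OF f in_L2[OF g] in_L2[OF k]] by simp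
  qed
  with g have "?P ?g"
    by blast
  then have "?P (L2_proj K f)"
    unfolding L2_proj_def by (rule someI[where P = ?P])
  then show "L2_proj K f \<in> K" "k \<in> K \<Longrightarrow> L2_inner (L2_proj K f) k = L2_inner f k"
    using L2_inner_diff_left[of f "L2_proj K f" k] f in_L2 by auto
qed

lemma L2_norm_proj_le:
  assumes "f \<in> L2"
  shows "L2_norm (L2_proj K f) \<le> L2_norm f"
proof -
  let ?g = "L2_proj K f"
  have g: "?g \<in> K"
    by (rule L2_proj_in[OF assms])
  have "of_real ((L2_norm ?g)\<^sup>2) = L2_inner f ?g"
    using L2_inner_proj[OF assms g] by (simp add: L2_inner_self)
  then have "(L2_norm ?g)\<^sup>2 \<le> L2_norm f * L2_norm ?g"
    using L2_Cauchy_Schwarz[OF assms in_L2[OF g]]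
    by (metis norm_of_real abs_of_nonneg zero_le_power2)
  then show ?thesis
    by (rule le_if_power2_le_mult) auto
qed

text \<open>
  Parseval's identity in one basis, and then in the other with \<open>A\<close> moved to the second argument as
  its adjoint, exchanges two orthonormal bases. So the trace may be computed in the basis \<open>E\<close>.
\<close>

lemma L2_trace_eq:
  assumes "adjoint_on K A A'"
  shows "L2_trace K A = (\<Sum>e\<in>E. L2_inner (A e) e)"
proof -
  define F where "F = (SOME E. L2_orthonormal_basis K E)"
  have "L2_orthonormal_basis K F"
    unfolding F_def using basis by (rule someI)
  then interpret F: L2_subspace K F
    by unfold_locales (use K_L2 K_zero K_add K_scale in auto)
  have "L2_trace K A = (\<Sum>f\<in>F. L2_inner (A f) f)"
    by (simp add: L2_trace_def F_def Let_def)
  also have "\<dots> = (\<Sum>f\<in>F. \<Sum>e\<in>E. L2_inner (A f) e * L2_inner e f)"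
    using Parseval in_L2 adjoint_onD[OF assms] F.E_in_K by (intro sum.cong refl) auto
  also have "\<dots> = (\<Sum>e\<in>E. \<Sum>f\<in>F. L2_inner e f * L2_inner f (A' e))"
    using adjoint_onD[OF assms] F.E_in_K E_in_K
    by (subst sum.swap, intro sum.cong refl) (simp add: mult.commute)
  also have "\<dots> = (\<Sum>e\<in>E. L2_inner e (A' e))"
    using F.Parseval[symmetric] in_L2 adjoint_onD(2)[OF assms] E_in_K by (intro sum.cong refl) simp
  also have "\<dots> = (\<Sum>e\<in>E. L2_inner (A e) e)"
    using adjoint_onD[OF assms] E_in_K by simp
  finally show ?thesis .
qed

subsection \<open>Compressions of multiplication operators\<close>

abbreviation compression :: "(complex \<Rightarrow> complex) \<Rightarrow> (complex \<Rightarrow> complex) \<Rightarrow> complex \<Rightarrow> complex" where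
  "compression \<phi> f \<equiv> L2_proj K (\<lambda>z. \<phi> z * f z)"

lemma compression:
  assumes "continuous_on (sphere 0 1) \<phi>" "f \<in> K"
  shows compression_in: "compression \<phi> f \<in> K"
    and L2_inner_compression: "k \<in> K \<Longrightarrow> L2_inner (compression \<phi> f) k = L2_inner (\<lambda>z. \<phi> z * f z) k"
  using L2_proj L2_mult_continuous assms in_L2 by auto

lemma adjoint_on_compression:
  assumes "continuous_on (sphere 0 1) \<phi>"
  shows "adjoint_on K (compression \<phi>) (compression (\<lambda>z. cnj (\<phi> z)))"
proof -
  have cont: "continuous_on (sphere 0 1) (\<lambda>z. cnj (\<phi> z))"
    by (intro continuous_intros assms)
  have "L2_inner (compression \<phi> f) k = L2_inner f (compression (\<lambda>z. cnj (\<phi> z)) k)"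
    if "f \<in> K" "k \<in> K" for f k
  proof -
    have "L2_inner f (compression (\<lambda>z. cnj (\<phi> z)) k) = L2_inner f (\<lambda>z. cnj (\<phi> z) * k z)"
      using L2_inner_compression[OF cont that(2,1)] by (metis L2_inner_commute)
    then show ?thesis
      using L2_inner_compression[OF assms that] by (simp add: L2_inner_mult_left)
  qed
  then show ?thesis
    using compression_in assms cont by (auto simp: adjoint_on_def)
qed

lemma L2_norm_compression_funpow_le:
  assumes \<phi>: "continuous_on (sphere 0 1) \<phi>" "\<And>z. norm z = 1 \<Longrightarrow> norm (\<phi> z) \<le> M" and f: "f \<in> K"
  shows "L2_norm ((compression \<phi> ^^ p) f) \<le> M ^ p * L2_norm f"
proof (induction p)
  case (Suc p)
  let ?h = "(compression \<phi> ^^ p) f"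
  have h: "?h \<in> L2"
    using adjoint_onD(1)[OF adjoint_on_funpow[OF adjoint_on_compression[OF \<phi>(1)]] f] in_L2 by blast
  have M: "M \<ge> 0"
    using \<phi>(2)[of 1] by (metis norm_ge_zero norm_one order_trans)
  have "L2_norm (compression \<phi> ?h) \<le> L2_norm (\<lambda>z. \<phi> z * ?h z)"
    by (intro L2_norm_proj_le L2_mult_continuous h \<phi>)
  also have "\<dots> \<le> M * L2_norm ?h"
    using h \<phi> continuous_on_circle_measurable by (intro L2_norm_mult_le) auto
  also have "\<dots> \<le> M * (M ^ p * L2_norm f)"
    using Suc M by (intro mult_left_mono) auto
  finally show ?case
    by (simp add: mult.assoc)
qed simp

text \<open>
  If multiplication by \<open>\<psi> - c\<close> nearly annihilates \<open>k\<close>, then \<open>k\<close> is nearly an eigenvector of the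
  compression of \<open>\<psi>\<close>. The step from \<open>p\<close> to \<open>p + 1\<close> moves \<open>\<psi> - c\<close> to the other side of the
  inner product.
\<close>

lemma compression_funpow_approx:
  fixes c :: complex
  assumes \<psi>: "continuous_on (sphere 0 1) \<psi>" "\<And>z. norm z = 1 \<Longrightarrow> norm (\<psi> z) \<le> M" and k: "k \<in> K"
    and c: "norm c \<le> M" and M: "M \<ge> 1"
    and \<delta>: "L2_norm (\<lambda>z. (\<psi> z - c) * k z) \<le> \<delta> * L2_norm k" "\<delta> \<ge> 0"
  shows "norm (L2_inner ((compression \<psi> ^^ p) k) k - c ^ p * (L2_norm k)\<^sup>2) \<le> p * M ^ p * \<delta> * (L2_norm k)\<^sup>2"
proof (induction p)
  case 0
  then show ?case by (simp add: L2_inner_self)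
next
  case (Suc p)
  let ?h = "(compression \<psi> ^^ p) k" and ?N = "(L2_norm k)\<^sup>2"
  have h: "?h \<in> K"
    using adjoint_onD(1)[OF adjoint_on_funpow[OF adjoint_on_compression[OF \<psi>(1)]] k] .
  let ?k = "\<lambda>z. cnj (\<psi> z - c) * k z"
  have kL2: "?k \<in> L2"
    using k in_L2 \<psi> by (intro L2_mult_continuous continuous_intros) auto
  have "L2_inner (compression \<psi> ?h) k - c * L2_inner ?h k
      = L2_inner (\<lambda>z. \<psi> z * ?h z - c * ?h z) k"
    using L2_inner_diff_left[of "\<lambda>z. \<psi> z * ?h z" "\<lambda>z. c * ?h z" k]
      L2_mult_continuous[OF in_L2[OF h] \<psi>(1)] L2_scale[OF in_L2[OF h]] in_L2[OF k]
    by (simp add: L2_inner_compression[OF \<psi>(1) h k] L2_inner_scale_left)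
  also have "\<dots> = L2_inner ?h ?k"
    using L2_inner_mult_left[of "\<lambda>z. \<psi> z - c" ?h k] by (simp add: left_diff_distrib)
  finally have eq: "L2_inner (compression \<psi> ?h) k - c * L2_inner ?h k = L2_inner ?h ?k" .
  have "L2_norm ?k = L2_norm (\<lambda>z. (\<psi> z - c) * k z)"
    unfolding L2_norm_def norm_mult complex_mod_cnj ..
  then have "L2_norm ?h * L2_norm ?k \<le> (M ^ p * L2_norm k) * (\<delta> * L2_norm k)"
    using M \<delta> by (intro mult_mono L2_norm_compression_funpow_le \<psi> k) auto
  then have 1: "norm (L2_inner (compression \<psi> ?h) k - c * L2_inner ?h k) \<le> M ^ p * \<delta> * ?N"
    unfolding eq using L2_Cauchy_Schwarz[OF in_L2[OF h] kL2]
    by (simp add: power2_eq_square mult_ac)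
  have 2: "norm (c * L2_inner ?h k - c * (c ^ p * ?N)) \<le> M * (p * M ^ p * \<delta> * ?N)"
    unfolding right_diff_distrib[symmetric] norm_mult using Suc c M by (intro mult_mono) auto
  have "norm (L2_inner (compression \<psi> ?h) k - c * (c ^ p * ?N))
      \<le> M ^ p * \<delta> * ?N + M * (p * M ^ p * \<delta> * ?N)"
    using norm_triangle_mono[OF 1 2] by simp
  also have "\<dots> \<le> M ^ Suc p * \<delta> * ?N + M * (p * M ^ p * \<delta> * ?N)"
    using M \<delta> by (intro add_right_mono mult_right_mono power_increasing) auto
  finally show ?case
    by (simp add: algebra_simps)
qed

subsection \<open>Traces as averages over the reproducing kernels\<close>

text \<open>
  For continuous basis functions this is the reproducing kernel of \<open>K\<close> at \<open>\<zeta>\<close>: the inner product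
  of \<open>f\<close> with it is the value at \<open>\<zeta>\<close> of the continuous representative of \<open>f\<close>.
\<close>

definition kernel :: "complex \<Rightarrow> complex \<Rightarrow> complex" where
  "kernel \<zeta> = (\<lambda>z. \<Sum>e\<in>E. cnj (e \<zeta>) * e z)"

lemma kernel_in: "kernel \<zeta> \<in> K"
  unfolding kernel_def using E_in_K by (intro K_sum)

lemma L2_inner_kernel:
  assumes "adjoint_on K A A'"
  shows "L2_inner (A (kernel \<zeta>)) (kernel \<zeta>) = (\<Sum>e\<in>E. \<Sum>e'\<in>E. L2_inner (A e) e' * (e' \<zeta> * cnj (e \<zeta>)))"
proof -
  let ?k = "kernel \<zeta>"
  have "L2_inner (A ?k) ?k = L2_inner ?k (A' ?k)"
    by (rule adjoint_onD(3)[OF assms kernel_in kernel_in])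
  also have "\<dots> = (\<Sum>e\<in>E. cnj (e \<zeta>) * L2_inner e (A' ?k))"
    using L2_inner_sum_left[of E "\<lambda>e. e" "A' ?k" "\<lambda>e. cnj (e \<zeta>)"]
      E_L2 in_L2[OF adjoint_onD(2)[OF assms kernel_in]]
    by (auto simp: kernel_def)
  also have "\<dots> = (\<Sum>e\<in>E. cnj (e \<zeta>) * L2_inner (A e) ?k)"
    using adjoint_onD(3)[OF assms E_in_K kernel_in] by simp
  also have "\<dots> = (\<Sum>e\<in>E. cnj (e \<zeta>) * (\<Sum>e'\<in>E. e' \<zeta> * L2_inner (A e) e'))"
  proof (intro sum.cong refl arg_cong2[where f = "(*)"])
    fix e assume "e \<in> E"
    then show "L2_inner (A e) ?k = (\<Sum>e'\<in>E. e' \<zeta> * L2_inner (A e) e')"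
      using E_L2 in_L2 E_in_K adjoint_onD(1)[OF assms]
        L2_inner_sum_right[of E "\<lambda>e. e" "A e" "\<lambda>e'. cnj (e' \<zeta>)"] by (auto simp: kernel_def)
  qed
  also have "\<dots> = (\<Sum>e\<in>E. \<Sum>e'\<in>E. L2_inner (A e) e' * (e' \<zeta> * cnj (e \<zeta>)))"
    by (simp add: sum_distrib_left mult_ac)
  finally show ?thesis .
qed

lemma L2_norm_kernel: "(L2_norm (kernel \<zeta>))\<^sup>2 = (\<Sum>e\<in>E. (norm (e \<zeta>))\<^sup>2)"
proof -
  have "adjoint_on K (\<lambda>f. f) (\<lambda>f. f)"
    by (auto simp: adjoint_on_def)
  then have "complex_of_real ((L2_norm (kernel \<zeta>))\<^sup>2)
      = (\<Sum>e\<in>E. \<Sum>e'\<in>E. L2_inner e e' * (e' \<zeta> * cnj (e \<zeta>)))"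
    using L2_inner_kernel[of "\<lambda>f. f"] by (simp add: L2_inner_self)
  also have "\<dots> = (\<Sum>e\<in>E. \<Sum>e'\<in>E. if e = e' then e' \<zeta> * cnj (e \<zeta>) else 0)"
    by (intro sum.cong refl) (simp add: E_orthonormal)
  also have "\<dots> = of_real (\<Sum>e\<in>E. (norm (e \<zeta>))\<^sup>2)"
    using finite_E by (simp add: complex_norm_square del: of_real_power)
  finally show ?thesis
    using of_real_eq_iff by blast
qed

text \<open>
  The function \<open>\<langle>A k\<^sub>\<zeta>, k\<^sub>\<zeta>\<rangle>\<close> of \<open>\<zeta>\<close> is the sum over the basis of the products \<open>(A b)(\<zeta>) cnj (b(\<zeta>))\<close>,
  so its integral against \<open>w\<close> is the sum of the diagonal entries \<open>\<langle>w A b, b\<rangle>\<close>.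
\<close>

lemma trace_compression_comp:
  assumes A: "adjoint_on K A A'" and w: "continuous_on (sphere 0 1) w"
    and E: "\<And>e. e \<in> E \<Longrightarrow> continuous_on (sphere 0 1) e"
  shows "L2_trace K (compression w \<circ> A)
    = (\<integral>\<zeta>. w \<zeta> * L2_inner (A (kernel \<zeta>)) (kernel \<zeta>) \<partial>circle_measure)"
proof -
  let ?i = "\<lambda>e e'. \<integral>\<zeta>. w \<zeta> * (e' \<zeta> * cnj (e \<zeta>)) \<partial>circle_measure"
  have int: "integrable circle_measure (\<lambda>\<zeta>. w \<zeta> * (e' \<zeta> * cnj (e \<zeta>)))" if "e \<in> E" "e' \<in> E" for e e'
    using that E w by (intro integrable_circle_continuous continuous_intros) auto
  have "L2_trace K (compression w \<circ> A) = (\<Sum>e\<in>E. L2_inner ((compression w \<circ> A) e) e)"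
    by (rule L2_trace_eq[OF adjoint_on_comp[OF adjoint_on_compression[OF w] A]])
  also have "\<dots> = (\<Sum>e\<in>E. L2_inner (A e) (\<lambda>z. cnj (w z) * e z))"
    using adjoint_onD(1)[OF A] E_in_K
    by (intro sum.cong refl) (simp add: L2_inner_compression[OF w] flip: L2_inner_mult_left)
  also have "\<dots> = (\<Sum>e\<in>E. \<Sum>e'\<in>E. L2_inner (A e) e' * L2_inner e' (\<lambda>z. cnj (w z) * e z))"
    using adjoint_onD(1)[OF A] E_in_K E_L2 w
    by (intro sum.cong refl Parseval L2_mult_continuous continuous_intros) auto
  also have "\<dots> = (\<Sum>e\<in>E. \<Sum>e'\<in>E. L2_inner (A e) e' * ?i e e')"
    unfolding L2_inner_def[of _ "\<lambda>z. cnj (w z) * _ z"] by (simp add: mult_ac)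
  also have "\<dots> = (\<Sum>e\<in>E. \<Sum>e'\<in>E. \<integral>\<zeta>. L2_inner (A e) e' * (w \<zeta> * (e' \<zeta> * cnj (e \<zeta>))) \<partial>circle_measure)"
    by simp
  also have "\<dots> = (\<integral>\<zeta>. (\<Sum>e\<in>E. \<Sum>e'\<in>E. L2_inner (A e) e' * (w \<zeta> * (e' \<zeta> * cnj (e \<zeta>)))) \<partial>circle_measure)"
    using int
    by (subst Bochner_Integration.integral_sum, fastforce)
       (intro sum.cong refl Bochner_Integration.integral_sum[symmetric], auto)
  also have "\<dots> = (\<integral>\<zeta>. w \<zeta> * L2_inner (A (kernel \<zeta>)) (kernel \<zeta>) \<partial>circle_measure)"
    by (simp add: L2_inner_kernel[OF A] sum_distrib_left mult_ac)
  finally show ?thesis .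
qed

end

section \<open>Spectral decomposition of self-adjoint operators\<close>

lemma homogeneous_system_solvable:
  fixes u :: "'i \<Rightarrow> 'e \<Rightarrow> 'a::field"
  assumes "finite E" "finite I" "card E < card I"
  shows "\<exists>c. (\<exists>i\<in>I. c i \<noteq> 0) \<and> (\<forall>e\<in>E. (\<Sum>i\<in>I. c i * u i e) = 0)"
  using assms
proof (induction E arbitrary: I u rule: finite_induct)
  case empty
  then have "I \<noteq> {}" by auto
  then show ?case by (intro exI[of _ "\<lambda>_. 1"]) auto
next
  case (insert e0 E)
  show ?case
  proof (cases "\<forall>i\<in>I. u i e0 = 0")
    case True
    then show ?thesis
      using insert.IH[of I u] insert.prems insert.hyps by auto
  next
    case False
    then obtain i0 where i0: "i0 \<in> I" "u i0 e0 \<noteq> 0" by auto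
    \<comment> \<open>Gaussian elimination of the unknown \<open>i0\<close> by means of the equation \<open>e0\<close>.\<close>
    let ?I = "I - {i0}"
    let ?q = "\<lambda>i. u i e0 / u i0 e0"
    have "\<exists>c. (\<exists>i\<in>?I. c i \<noteq> 0) \<and> (\<forall>e\<in>E. (\<Sum>i\<in>?I. c i * (u i e - ?q i * u i0 e)) = 0)"
      using insert.prems insert.hyps i0 by (intro insert.IH) auto
    then obtain c where c: "\<exists>i\<in>?I. c i \<noteq> 0"
      and c0: "\<And>e. e \<in> E \<Longrightarrow> (\<Sum>i\<in>?I. c i * (u i e - ?q i * u i0 e)) = 0" by auto
    define d where "d = c(i0 := - (\<Sum>i\<in>?I. c i * ?q i))"
    have "(\<Sum>i\<in>I. d i * u i e) = (\<Sum>i\<in>?I. c i * (u i e - ?q i * u i0 e))" for e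
    proof -
      have "(\<Sum>i\<in>I. d i * u i e) = d i0 * u i0 e + (\<Sum>i\<in>?I. d i * u i e)"
        using i0 insert.prems by (subst sum.remove) auto
      also have "(\<Sum>i\<in>?I. d i * u i e) = (\<Sum>i\<in>?I. c i * u i e)"
        by (intro sum.cong) (auto simp: d_def)
      finally show ?thesis
        by (simp add: d_def right_diff_distrib sum_subtractf sum_distrib_right mult.assoc)
    qed
    moreover have "(\<Sum>i\<in>?I. c i * (u i e0 - ?q i * u i0 e0)) = 0"
      using i0 by simp
    moreover have "\<exists>i\<in>I. d i \<noteq> 0"
      using c by (auto simp: d_def)
    ultimately show ?thesis
      using c0 by (intro exI[of _ d]) auto
  qed
qed

lemma norm_L2_inner_commute: "norm (L2_inner f g) = norm (L2_inner g f)"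
  by (subst L2_inner_commute) (simp only: complex_mod_cnj)

context L2_subspace
begin

lemma inner_eq_all_if_E:
  assumes "f \<in> K" "g \<in> K" "k \<in> K" "\<And>e. e \<in> E \<Longrightarrow> L2_inner f e = L2_inner g e"
  shows "L2_inner f k = L2_inner g k"
  using AE_eq_if_inner_eq[OF assms(1,2,4)] assms in_L2 by (intro L2_inner_cong) auto

text \<open>
  The nonzero polynomial \<open>q\<close> of least degree with \<open>q(A) h = 0\<close> exists because
  \<open>h, A h, A\<^sup>2 h, \<dots>\<close> are dependent, and it has a root \<open>c\<close>. Then \<open>r(A) h\<close>, where
  \<open>q(x) = (x - c) r(x)\<close>, is an eigenvector. Its form as a combination of the \<open>A\<^sup>i h\<close> keeps it
  orthogonal to everything that all of these are orthogonal to.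
\<close>

lemma eigenvector_in_cyclic_subspace:
  assumes A: "adjoint_on K A A'" and h: "h \<in> K" "L2_norm h \<noteq> 0"
  obtains a N c where "L2_norm (\<lambda>z. \<Sum>i\<le>N. a i * (A ^^ i) h z) \<noteq> 0"
    "\<And>k. k \<in> K \<Longrightarrow> L2_inner (A (\<lambda>z. \<Sum>i\<le>N::nat. a i * (A ^^ i) h z)) k
        = c * L2_inner (\<lambda>z. \<Sum>i\<le>N. a i * (A ^^ i) h z) k"
proof -
  define v where "v q = (\<lambda>z. \<Sum>i\<le>degree q. coeff q i * (A ^^ i) h z)" for q
  have Ah: "(A ^^ i) h \<in> K" for i
    using adjoint_onD(1)[OF adjoint_on_funpow[OF A]] h by blast
  have v_in: "v q \<in> K" for q
    unfolding v_def by (intro K_sum Ah)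
  have v_inner: "L2_inner (v q) k = (\<Sum>i\<le>N. coeff q i * L2_inner ((A ^^ i) h) k)"
    if "k \<in> K" "degree q \<le> N" for q k N
  proof -
    have "L2_inner (v q) k = (\<Sum>i\<le>degree q. coeff q i * L2_inner ((A ^^ i) h) k)"
      unfolding v_def using in_L2 Ah that by (intro L2_inner_sum_left) auto
    also have "\<dots> = (\<Sum>i\<le>N. coeff q i * L2_inner ((A ^^ i) h) k)"
      using that by (intro sum.mono_neutral_left) (auto simp: coeff_eq_0)
    finally show ?thesis .
  qed
  define ann where "ann q \<longleftrightarrow> q \<noteq> 0 \<and> (\<forall>k\<in>K. L2_inner (v q) k = 0)" for q
  have "\<exists>q. ann q"
  proof -
    obtain c where c: "\<exists>i\<in>{..card E}. c i \<noteq> 0"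
        "\<And>e. e \<in> E \<Longrightarrow> (\<Sum>i\<le>card E. c i * L2_inner ((A ^^ i) h) e) = 0"
      using homogeneous_system_solvable[OF finite_E, of "{..card E}" "\<lambda>i. L2_inner ((A ^^ i) h)"] by auto
    define q where "q = (\<Sum>i\<le>card E. monom (c i) i)"
    have coeff_q: "coeff q i = (if i \<le> card E then c i else 0)" for i
      unfolding q_def coeff_sum by (simp add: coeff_monom)
    have "L2_inner (v q) e = 0" if "e \<in> E" for e
    proof -
      have "degree q \<le> card E"
        by (intro degree_le) (simp add: coeff_q)
      then have "L2_inner (v q) e = (\<Sum>i\<le>card E. coeff q i * L2_inner ((A ^^ i) h) e)"
        using that E_in_K by (intro v_inner)
      then show ?thesis
        using c(2)[OF that] by (simp add: coeff_q)
    qed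
    then have "L2_inner (v q) k = 0" if "k \<in> K" for k
      using inner_eq_all_if_E[OF v_in K_zero that] by (simp add: L2_inner_def)
    moreover have "q \<noteq> 0"
      using c(1) coeff_q by (metis atMost_iff coeff_0)
    ultimately show ?thesis
      by (auto simp: ann_def)
  qed
  then obtain q where q: "ann q" and q_min: "\<And>r. ann r \<Longrightarrow> degree q \<le> degree r"
    using arg_min_natI[of ann _ degree] arg_min_nat_le[of ann _ degree] by metis
  have "degree q \<noteq> 0"
  proof
    assume "degree q = 0"
    then have "coeff q 0 * L2_inner h h = 0" "coeff q 0 \<noteq> 0"
      using q v_inner[OF h(1), of q 0] h by (auto simp: ann_def leading_coeff_0_iff[symmetric])
    then show False
      using h by (simp add: L2_inner_self)
  qed
  then obtain c where "poly q c = 0"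
    using Fundamental_Theorem_Algebra.fundamental_theorem_of_algebra[of q] by (auto simp: constant_degree)
  then obtain r where qr: "q = [:- c, 1:] * r"
    by (metis dvdE poly_eq_0_iff_dvd)
  have r0: "r \<noteq> 0"
    using qr q by (auto simp: ann_def)
  then have deg: "degree q = Suc (degree r)"
    unfolding qr by (subst degree_mult_eq) auto
  have Av: "L2_inner (A (v r)) k = c * L2_inner (v r) k" if k: "k \<in> K" for k
  proof -
    let ?s = "\<lambda>i. L2_inner ((A ^^ i) h) k"
    have "L2_inner (A (v r)) k = L2_inner (v r) (A' k)"
      by (rule adjoint_onD(3)[OF A v_in k])
    also have "\<dots> = (\<Sum>i\<le>degree r. coeff r i * L2_inner ((A ^^ i) h) (A' k))"
      by (rule v_inner[OF adjoint_onD(2)[OF A k]]) simp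
    also have "\<dots> = (\<Sum>i\<le>degree r. coeff r i * ?s (Suc i))"
      using adjoint_onD(3)[OF A Ah k] by simp
    also have "\<dots> = (\<Sum>i\<le>Suc (degree r). coeff (pCons 0 r) i * ?s i)"
      by (subst sum.atMost_Suc_shift) simp
    finally have 1: "L2_inner (A (v r)) k = \<dots>" .
    have 2: "L2_inner (v r) k = (\<Sum>i\<le>Suc (degree r). coeff r i * ?s i)"
      by (rule v_inner[OF k]) simp
    have "L2_inner (A (v r)) k - c * L2_inner (v r) k
        = (\<Sum>i\<le>Suc (degree r). (coeff (pCons 0 r) i - c * coeff r i) * ?s i)"
      unfolding 1 2 by (simp only: left_diff_distrib sum_subtractf sum_distrib_left mult.assoc)
    also have "\<dots> = (\<Sum>i\<le>Suc (degree r). coeff q i * ?s i)"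
      by (simp add: qr)
    also have "\<dots> = 0"
      using v_inner[OF k, of q "Suc (degree r)"] q k deg by (auto simp: ann_def)
    finally show ?thesis by simp
  qed
  have "L2_norm (v r) \<noteq> 0"
  proof
    assume "L2_norm (v r) = 0"
    then have "L2_inner (v r) k = 0" if "k \<in> K" for k
      using L2_Cauchy_Schwarz[of "v r" k] in_L2 v_in that by auto
    then have "ann r"
      using r0 by (auto simp: ann_def)
    then show False
      using q_min deg by fastforce
  qed
  with Av show thesis
    using that[of "coeff r" "degree r" c] unfolding v_def by blast
qed

lemma card_orthonormal_le:
  assumes F: "finite F" "F \<subseteq> K"
    and on: "\<And>f f'. f \<in> F \<Longrightarrow> f' \<in> F \<Longrightarrow> L2_inner f f' = (if f = f' then 1 else 0)"
  shows "card F \<le> card E"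
proof -
  have norm1: "(L2_norm f)\<^sup>2 = 1" if "L2_inner f f = 1" for f
    using that unfolding L2_inner_self by (metis of_real_eq_1_iff)
  have "real (card F) = (\<Sum>f\<in>F. \<Sum>e\<in>E. (norm (L2_inner f e))\<^sup>2)"
  proof -
    have "(\<Sum>e\<in>E. (norm (L2_inner f e))\<^sup>2) = 1" if "f \<in> F" for f
      using Parseval_norm[of f] norm1[of f] on that F by auto
    then show ?thesis by simp
  qed
  also have "\<dots> = (\<Sum>e\<in>E. \<Sum>f\<in>F. (norm (L2_inner f e))\<^sup>2)"
    by (rule sum.swap)
  also have "\<dots> = (\<Sum>e\<in>E. \<Sum>f\<in>F. (norm (L2_inner e f))\<^sup>2)"
    by (intro sum.cong refl arg_cong[where f = "\<lambda>x. x\<^sup>2"] norm_L2_inner_commute)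
  also have "\<dots> \<le> (\<Sum>e\<in>E. (L2_norm e)\<^sup>2)"
    using F K_L2 E_L2 on by (intro sum_mono L2_Bessel) auto
  also have "\<dots> = real (card E)"
    using norm1 E_orthonormal by simp
  finally show ?thesis by simp
qed

text \<open>
  A maximal orthonormal set of eigenvectors spans: its orthogonal complement is invariant under
  \<open>T\<close> and would otherwise contain one more eigenvector.
\<close>

lemma orthonormal_eigenbasis:
  assumes T: "adjoint_on K T T"
  obtains F \<mu> where "L2_orthonormal_basis K F"
    "\<And>f. f \<in> F \<Longrightarrow> AE z in circle_measure. T f z = complex_of_real (\<mu> f) * f z"
proof -
  define orth where "orth F \<longleftrightarrow> finite F \<and> F \<subseteq> K \<and>
    (\<forall>f\<in>F. \<forall>f'\<in>F. L2_inner f f' = (if f = f' then 1 else 0))" for F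
  define eig where "eig f \<longleftrightarrow> (\<exists>c::real. \<forall>k\<in>K. L2_inner (T f) k = c * L2_inner f k)" for f
  obtain F where F: "orth F" "\<forall>f\<in>F. eig f"
    and F_max: "\<And>F'. orth F' \<Longrightarrow> \<forall>f\<in>F'. eig f \<Longrightarrow> card F' \<le> card F"
  proof -
    let ?Q = "\<lambda>F. orth F \<and> (\<forall>f\<in>F. eig f)"
    have "?Q {}"
      by (simp add: orth_def)
    moreover have "\<forall>F. ?Q F \<longrightarrow> card F < Suc (card E)"
      using card_orthonormal_le by (auto simp: orth_def le_imp_less_Suc)
    ultimately have "\<exists>F. ?Q F \<and> (\<forall>F'. ?Q F' \<longrightarrow> card F' \<le> card F)"
      by (rule ex_has_greatest_nat)
    then show thesis
      using that by blast
  qed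
  have F_K: "finite F" "F \<subseteq> K" and
    F_on: "\<And>f f'. f \<in> F \<Longrightarrow> f' \<in> F \<Longrightarrow> L2_inner f f' = (if f = f' then 1 else 0)"
    using F(1) by (auto simp: orth_def)
  have span: "AE z in circle_measure. g z = (\<Sum>f\<in>F. L2_inner g f * f z)" if g: "g \<in> K" for g
  proof -
    let ?s = "\<lambda>z. \<Sum>f\<in>F. L2_inner g f * f z"
    define h where "h = (\<lambda>z. g z + (-1) * ?s z)"
    have s: "?s \<in> K"
      using F_K by (intro K_sum) auto
    then have h: "h \<in> K"
      unfolding h_def by (rule K_add[OF g K_scale])
    have h_perp: "L2_inner h f = 0" if f: "f \<in> F" for f
    proof -
      have fK: "f \<in> K" using f F_K by auto
      have "L2_inner ?s f = (\<Sum>f'\<in>F. L2_inner g f' * L2_inner f' f)"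
        using F_K in_L2 fK by (intro L2_inner_sum_left) auto
      also have "\<dots> = (\<Sum>f'\<in>F. if f' = f then L2_inner g f' else 0)"
        using F_on f by (intro sum.cong) auto
      also have "\<dots> = L2_inner g f"
        using F_K f by simp
      finally show ?thesis
        using L2_inner_diff_left[OF in_L2[OF g] in_L2[OF s] in_L2[OF fK]] by (simp add: h_def)
    qed
    have "L2_norm h = 0"
    proof (rule ccontr)
      assume h0: "L2_norm h \<noteq> 0"
      obtain a N c where v0: "L2_norm (\<lambda>z. \<Sum>i\<le>N::nat. a i * (T ^^ i) h z) \<noteq> 0"
        and Tv: "\<And>k. k \<in> K \<Longrightarrow> L2_inner (T (\<lambda>z. \<Sum>i\<le>N. a i * (T ^^ i) h z)) k
          = c * L2_inner (\<lambda>z. \<Sum>i\<le>N. a i * (T ^^ i) h z) k"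
        by (rule eigenvector_in_cyclic_subspace[OF T h h0]) (rule that, assumption, blast)
      define v where "v = (\<lambda>z. \<Sum>i\<le>N. a i * (T ^^ i) h z)"
      have Th: "(T ^^ i) h \<in> K" for i
        using adjoint_onD(1)[OF adjoint_on_funpow[OF T] h] .
      have v: "v \<in> K"
        unfolding v_def using Th by (intro K_sum)
      have Th_perp: "L2_inner ((T ^^ i) h) f = 0" if f: "f \<in> F" for f i
      proof (induction i)
        case (Suc i)
        have fK: "f \<in> K" using f F_K by auto
        obtain c' :: real where c': "\<forall>k\<in>K. L2_inner (T f) k = c' * L2_inner f k"
          using F(2) f by (auto simp: eig_def)
        have "L2_inner ((T ^^ Suc i) h) f = cnj (L2_inner (T f) ((T ^^ i) h))"
          using adjoint_onD(3)[OF T Th fK] by simp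
        also have "\<dots> = c' * L2_inner ((T ^^ i) h) f"
          using c' Th by simp
        finally show ?case
          using Suc by simp
      qed (use h_perp f in simp)
      have v_perp: "L2_inner v f = 0" if f: "f \<in> F" for f
      proof -
        have "L2_inner v f = (\<Sum>i\<le>N. a i * L2_inner ((T ^^ i) h) f)"
          unfolding v_def using in_L2 Th f F_K by (intro L2_inner_sum_left) auto
        then show ?thesis
          using Th_perp[OF f] by simp
      qed
      have "c * L2_inner v v = cnj c * L2_inner v v"
      proof -
        have "c * L2_inner v v = L2_inner v (T v)"
          using Tv[OF v] adjoint_onD(3)[OF T v v] by (simp add: v_def)
        also have "\<dots> = cnj (L2_inner (T v) v)"
          by simp
        also have "\<dots> = cnj c * L2_inner v v"
          using Tv[OF v] unfolding v_def[symmetric] by simp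
        finally show ?thesis .
      qed
      then have c_real: "c = of_real (Re c)"
        using v0 by (simp add: v_def[symmetric] L2_inner_self complex_eq_iff)
      define u where "u = (\<lambda>z. of_real (1 / L2_norm v) * v z)"
      have u: "u \<in> K"
        unfolding u_def by (rule K_scale[OF v])
      have "L2_inner u u = 1"
        using v0 unfolding u_def L2_inner_scale_left L2_inner_scale_right L2_inner_self v_def[symmetric]
        by (simp add: power2_eq_square)
      moreover have u_perp: "L2_inner u f = 0" "L2_inner f u = 0" if "f \<in> F" for f
        using v_perp[OF that] L2_inner_commute[of f v]
        unfolding u_def L2_inner_scale_left L2_inner_scale_right by simp_all
      ultimately have "orth (insert u F)"
        using u F(1) by (auto simp: orth_def)
      moreover have "eig u"
        unfolding eig_def
      proof (intro exI ballI)
        fix k assume k: "k \<in> K"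
        have "L2_inner (T u) k = of_real (1 / L2_norm v) * L2_inner v (T k)"
          unfolding adjoint_onD(3)[OF T u k] by (simp only: u_def L2_inner_scale_left)
        also have "L2_inner v (T k) = c * L2_inner v k"
          using adjoint_onD(3)[OF T v k] Tv[OF k] by (simp add: v_def)
        also have "of_real (1 / L2_norm v) * \<dots> = of_real (Re c) * L2_inner u k"
          by (subst c_real) (simp only: u_def L2_inner_scale_left mult.left_commute)
        finally show "L2_inner (T u) k = of_real (Re c) * L2_inner u k" .
      qed
      ultimately have "card (insert u F) \<le> card F"
        using F(2) by (intro F_max) auto
      moreover have "u \<notin> F"
        using u_perp \<open>L2_inner u u = 1\<close> by force
      ultimately show False
        using F_K by simp
    qed
    then have "AE z in circle_measure. h z = 0"
      using L2_norm_eq_0[OF in_L2[OF h]] by simp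
    then show ?thesis
      by eventually_elim (simp add: h_def)
  qed
  have "\<forall>f\<in>F. \<exists>c::real. \<forall>k\<in>K. L2_inner (T f) k = c * L2_inner f k"
    using F(2) by (simp add: eig_def)
  then obtain \<mu> :: "(complex \<Rightarrow> complex) \<Rightarrow> real"
    where \<mu>: "\<forall>f\<in>F. \<forall>k\<in>K. L2_inner (T f) k = \<mu> f * L2_inner f k"
    by (rule bchoice[THEN exE])
  have "AE z in circle_measure. T f z = complex_of_real (\<mu> f) * f z" if f: "f \<in> F" for f
  proof -
    have fK: "f \<in> K" using f F_K by auto
    have "L2_inner (T f) b = L2_inner (\<lambda>z. of_real (\<mu> f) * f z) b" if "b \<in> E" for b
      unfolding L2_inner_scale_left using \<mu> f E_in_K[OF that] by blast
    then show ?thesis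
      by (rule AE_eq_if_inner_eq[OF adjoint_onD(1)[OF T fK] K_scale[OF fK]])
  qed
  moreover have "L2_orthonormal_basis K F"
    unfolding L2_orthonormal_basis_def using F_K F_on span by auto
  ultimately show thesis
    using that by blast
qed

end

subsection \<open>The functional calculus in an eigenbasis\<close>

context L2_subspace
begin

lemma L2_eigenspace_iff:
  assumes "adjoint_on K A A'"
  shows "f \<in> L2_eigenspace K A c \<longleftrightarrow> f \<in> K \<and> (\<forall>k\<in>K. L2_inner f (A' k) = c * L2_inner f k)"
proof (cases "f \<in> K")
  case f: True
  have Af: "A f \<in> K" and cf: "(\<lambda>z. c * f z) \<in> K"
    using adjoint_onD(1)[OF assms f] K_scale[OF f] by auto
  have "(AE z in circle_measure. A f z = c * f z) \<longleftrightarrow> (\<forall>k\<in>K. L2_inner (A f) k = L2_inner (\<lambda>z. c * f z) k)"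
  proof
    assume "AE z in circle_measure. A f z = c * f z"
    then show "\<forall>k\<in>K. L2_inner (A f) k = L2_inner (\<lambda>z. c * f z) k"
      using L2_inner_cong[OF _ in_L2[OF Af] in_L2[OF cf] in_L2] by blast
  next
    assume "\<forall>k\<in>K. L2_inner (A f) k = L2_inner (\<lambda>z. c * f z) k"
    then show "AE z in circle_measure. A f z = c * f z"
      using E_in_K by (intro AE_eq_if_inner_eq[OF Af cf]) blast
  qed
  then show ?thesis
    using f adjoint_onD(3)[OF assms f] by (simp add: L2_eigenspace_def L2_inner_scale_left)
qed (simp add: L2_eigenspace_def)

end

locale L2_eigenbasis = L2_subspace K F for K F +
  fixes T :: "(complex \<Rightarrow> complex) \<Rightarrow> complex \<Rightarrow> complex" and \<mu> :: "(complex \<Rightarrow> complex) \<Rightarrow> real"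
  assumes self_adjoint: "adjoint_on K T T"
    and eigen: "\<And>f. f \<in> F \<Longrightarrow> AE z in circle_measure. T f z = complex_of_real (\<mu> f) * f z"
begin

lemma F_eigenspace: "b \<in> F \<Longrightarrow> b \<in> L2_eigenspace K T (\<mu> b)"
  using eigen E_in_K by (simp add: L2_eigenspace_def)

lemma inner_T_F:
  assumes "b \<in> F" "f \<in> K"
  shows "L2_inner f (T b) = \<mu> b * L2_inner f b"
proof -
  have "L2_inner b (T f) = \<mu> b * L2_inner b f"
    using F_eigenspace[OF assms(1)] assms(2) L2_eigenspace_iff[OF self_adjoint] by blast
  then have "cnj (L2_inner b (T f)) = \<mu> b * L2_inner f b"
    by simp
  then show ?thesis
    using adjoint_onD(3)[OF self_adjoint assms(2) E_in_K[OF assms(1)]] by simp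
qed

lemma eigenspace_inner_F_eq_0:
  assumes "f \<in> L2_eigenspace K T c" "b \<in> F" "c \<noteq> \<mu> b"
  shows "L2_inner f b = 0"
proof -
  have "f \<in> K" "L2_inner f (T b) = c * L2_inner f b"
    using assms E_in_K L2_eigenspace_iff[OF self_adjoint] by auto
  then have "(c - \<mu> b) * L2_inner f b = 0"
    using inner_T_F[OF assms(2)] by (auto simp: left_diff_distrib)
  then show ?thesis
    using assms(3) by simp
qed

lemma L2_subspace_eigenspace: "L2_subspace (L2_eigenspace K T c) {b \<in> F. \<mu> b = c}"
proof
  note iff = L2_eigenspace_iff[OF self_adjoint]
  show "L2_eigenspace K T c \<subseteq> L2"
    using in_L2 by (auto simp: L2_eigenspace_def)
  show "(\<lambda>z. 0) \<in> L2_eigenspace K T c"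
    unfolding iff using K_zero by (simp add: L2_inner_def)
  show "(\<lambda>z. f z + g z) \<in> L2_eigenspace K T c"
    if "f \<in> L2_eigenspace K T c" "g \<in> L2_eigenspace K T c" for f g
    using that L2_inner_add_left[OF in_L2 in_L2 in_L2] K_add adjoint_onD(1)[OF self_adjoint]
    unfolding iff by (auto simp: distrib_left)
  show "(\<lambda>z. a * f z) \<in> L2_eigenspace K T c" if "f \<in> L2_eigenspace K T c" for f a
    using that K_scale unfolding iff by (auto simp: L2_inner_scale_left)
  show "L2_orthonormal_basis (L2_eigenspace K T c) {b \<in> F. \<mu> b = c}"
    unfolding L2_orthonormal_basis_def
  proof (intro conjI ballI)
    show "finite {b \<in> F. \<mu> b = c}"
      using finite_E by simp
    show "{b \<in> F. \<mu> b = c} \<subseteq> L2_eigenspace K T c"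
      using F_eigenspace by auto
    show "L2_inner b b' = (if b = b' then 1 else 0)" if "b \<in> {b \<in> F. \<mu> b = c}" "b' \<in> {b \<in> F. \<mu> b = c}" for b b'
      using that E_orthonormal by auto
    fix f assume f: "f \<in> L2_eigenspace K T c"
    then have "f \<in> K"
      by (simp add: L2_eigenspace_def)
    then have "AE z in circle_measure. f z = (\<Sum>b\<in>F. L2_inner f b * b z)"
      by (rule E_expansion)
    moreover have "(\<Sum>b\<in>F. L2_inner f b * b z) = (\<Sum>b\<in>{b \<in> F. \<mu> b = c}. L2_inner f b * b z)" for z
      using finite_E eigenspace_inner_F_eq_0[OF f] by (intro sum.mono_neutral_right) auto
    ultimately show "AE z in circle_measure. f z = (\<Sum>b\<in>{b \<in> F. \<mu> b = c}. L2_inner f b * b z)"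
      by simp
  qed
qed

lemma L2_spectrum_eq: "L2_spectrum K T = \<mu> ` F"
proof (intro equalityI subsetI)
  fix c assume "c \<in> L2_spectrum K T"
  then obtain f where f: "f \<in> L2_eigenspace K T c" "\<not> (AE z in circle_measure. f z = 0)"
    by (auto simp: L2_spectrum_def)
  show "c \<in> \<mu> ` F"
  proof (rule ccontr)
    assume c: "c \<notin> \<mu> ` F"
    have "L2_inner f b = 0" if "b \<in> F" for b
      using c that by (intro eigenspace_inner_F_eq_0[OF f(1) that]) auto
    moreover have "f \<in> K"
      using f by (simp add: L2_eigenspace_def)
    ultimately show False
      using E_expansion f by fastforce
  qed
next
  fix c assume "c \<in> \<mu> ` F"
  then obtain b where b: "b \<in> F" "c = \<mu> b" by auto
  have "L2_norm b \<noteq> 0"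
    using E_orthonormal[OF b(1) b(1)] by (auto simp: L2_inner_self)
  then have "\<not> (AE z in circle_measure. b z = 0)"
    using L2_norm_eq_0 E_L2 b by blast
  then show "c \<in> L2_spectrum K T"
    using F_eigenspace[OF b(1)] b by (auto simp: L2_spectrum_def)
qed

lemma fun_calc_in:
  assumes "f \<in> K"
  shows "L2_fun_calc K T g f \<in> K"
proof -
  have "L2_proj (L2_eigenspace K T (complex_of_real c)) f \<in> K" for c
  proof -
    interpret Ec: L2_subspace "L2_eigenspace K T c" "{b \<in> F. \<mu> b = c}"
      using L2_subspace_eigenspace[of "of_real c"] by simp
    show ?thesis
      using Ec.L2_proj_in[OF in_L2[OF assms]] by (simp add: L2_eigenspace_def)
  qed
  then show ?thesis
    unfolding L2_fun_calc_def by (intro K_sum)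
qed

lemma inner_fun_calc:
  assumes f: "f \<in> K" and h: "h \<in> L2"
  shows "L2_inner (L2_fun_calc K T g f) h = (\<Sum>b\<in>F. g (\<mu> b) * (L2_inner f b * L2_inner b h))"
proof -
  let ?P = "\<lambda>c::real. L2_proj (L2_eigenspace K T c) f"
  have P: "?P c \<in> L2 \<and> L2_inner (?P c) h = (\<Sum>b\<in>{b \<in> F. \<mu> b = c}. L2_inner f b * L2_inner b h)" for c
  proof -
    interpret Ec: L2_subspace "L2_eigenspace K T c" "{b \<in> F. \<mu> b = c}"
      using L2_subspace_eigenspace[of "of_real c"] by simp
    have Pc: "?P c \<in> L2_eigenspace K T c"
      by (rule Ec.L2_proj_in[OF in_L2[OF f]])
    have "L2_inner (?P c) h = (\<Sum>b\<in>{b \<in> F. \<mu> b = c}. L2_inner (?P c) b * L2_inner b h)"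
      by (rule Ec.Parseval[OF Pc h])
    also have "\<dots> = (\<Sum>b\<in>{b \<in> F. \<mu> b = c}. L2_inner f b * L2_inner b h)"
      using Ec.L2_inner_proj[OF in_L2[OF f] Ec.E_in_K] by (intro sum.cong) auto
    finally show ?thesis
      using Ec.in_L2[OF Pc] by simp
  qed
  have "L2_inner (L2_fun_calc K T g f) h = (\<Sum>c\<in>\<mu> ` F. g c * L2_inner (?P c) h)"
    unfolding L2_fun_calc_def L2_spectrum_eq using P h by (intro L2_inner_sum_left) auto
  also have "\<dots> = (\<Sum>c\<in>\<mu> ` F. \<Sum>b\<in>{b \<in> F. \<mu> b = c}. g (\<mu> b) * (L2_inner f b * L2_inner b h))"
    using P by (simp add: sum_distrib_left)
  also have "\<dots> = (\<Sum>b\<in>F. g (\<mu> b) * (L2_inner f b * L2_inner b h))"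
    using finite_E by (rule sum.image_gen[symmetric])
  finally show ?thesis .
qed

lemma adjoint_on_fun_calc: "adjoint_on K (L2_fun_calc K T g) (L2_fun_calc K T (\<lambda>x. cnj (g x)))"
proof -
  have "L2_inner (L2_fun_calc K T g f) k = L2_inner f (L2_fun_calc K T (\<lambda>x. cnj (g x)) k)"
    if "f \<in> K" "k \<in> K" for f k
  proof -
    have "L2_inner f (L2_fun_calc K T (\<lambda>x. cnj (g x)) k)
        = cnj (L2_inner (L2_fun_calc K T (\<lambda>x. cnj (g x)) k) f)"
      by simp
    also have "\<dots> = (\<Sum>b\<in>F. g (\<mu> b) * (L2_inner f b * L2_inner b k))"
      unfolding inner_fun_calc[OF that(2) in_L2[OF that(1)]] by (simp add: mult_ac)
    finally show ?thesis
      by (simp add: inner_fun_calc[OF that(1) in_L2[OF that(2)]])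
  qed
  then show ?thesis
    using fun_calc_in by (auto simp: adjoint_on_def)
qed

end

context L2_subspace
begin

lemma adjoint_on_compression_real:
  assumes "continuous_on (sphere 0 1) \<psi>" "\<And>z. norm z = 1 \<Longrightarrow> \<psi> z \<in> \<real>"
  shows "adjoint_on K (compression \<psi>) (compression \<psi>)"
proof -
  have "L2_inner (compression \<psi> f) k = L2_inner f (compression \<psi> k)" if "f \<in> K" "k \<in> K" for f k
  proof -
    have "L2_inner (\<lambda>z. \<psi> z * f z) k = L2_inner f (\<lambda>z. \<psi> z * k z)"
      unfolding L2_inner_def
    proof (intro Bochner_Integration.integral_cong refl)
      fix z assume "z \<in> space circle_measure"
      then have "cnj (\<psi> z) = \<psi> z"
        using assms(2)[of z] by (simp add: Reals_cnj_iff)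
      then show "\<psi> z * f z * cnj (k z) = f z * cnj (\<psi> z * k z)"
        by simp
    qed
    then show ?thesis
      using L2_inner_compression[OF assms(1) that] L2_inner_compression[OF assms(1) that(2,1)]
      by (metis cnj_L2_inner)
  qed
  then show ?thesis
    using compression_in[OF assms(1)] by (auto simp: adjoint_on_def)
qed

end

locale L2_compression_eigenbasis = L2_subspace K F for K F +
  fixes \<psi> :: "complex \<Rightarrow> complex" and \<mu> :: "(complex \<Rightarrow> complex) \<Rightarrow> real"
  assumes \<psi>_continuous: "continuous_on (sphere 0 1) \<psi>"
    and \<psi>_real: "\<And>z. norm z = 1 \<Longrightarrow> \<psi> z \<in> \<real>"
    and eigen: "\<And>f. f \<in> F \<Longrightarrow> AE z in circle_measure. compression \<psi> f z = complex_of_real (\<mu> f) * f z"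
begin

sublocale L2_eigenbasis K F "compression \<psi>" \<mu>
  using adjoint_on_compression_real[OF \<psi>_continuous \<psi>_real] eigen by unfold_locales

lemma inner_mult_F:
  assumes "k \<in> K" "b \<in> F"
  shows "L2_inner (\<lambda>z. \<psi> z * k z) b = \<mu> b * L2_inner k b"
  using L2_inner_compression[OF \<psi>_continuous assms(1) E_in_K[OF assms(2)]]
    adjoint_onD(3)[OF self_adjoint assms(1) E_in_K[OF assms(2)]] inner_T_F[OF assms(2,1)] by simp

lemma eigenvalue_bounds:
  assumes b: "b \<in> F" and bounds: "\<And>z. norm z = 1 \<Longrightarrow> Re (\<psi> z) \<in> {x..y}"
  shows "\<mu> b \<in> {x..y}"
proof -
  have bL2: "b \<in> L2" and bb: "L2_inner b b = 1"
    using b E_L2 E_orthonormal by auto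
  have norm_b: "(\<integral>z. (norm (b z))\<^sup>2 \<partial>circle_measure) = 1"
    using bb unfolding L2_inner_self L2_norm_sq of_real_eq_1_iff .
  have "complex_of_real (\<mu> b) = L2_inner (\<lambda>z. \<psi> z * b z) b"
    using inner_mult_F[OF E_in_K[OF b] b] bb by simp
  also have "\<dots> = (\<integral>z. of_real (Re (\<psi> z) * (norm (b z))\<^sup>2) \<partial>circle_measure)"
    unfolding L2_inner_def
  proof (intro Bochner_Integration.integral_cong refl)
    fix z assume "z \<in> space circle_measure"
    then have "of_real (Re (\<psi> z)) = \<psi> z"
      using \<psi>_real[of z] by simp
    then show "\<psi> z * b z * cnj (b z) = of_real (Re (\<psi> z) * (norm (b z))\<^sup>2)"
      by (simp add: complex_norm_square mult.assoc del: of_real_power)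
  qed
  also have "\<dots> = of_real (\<integral>z. Re (\<psi> z) * (norm (b z))\<^sup>2 \<partial>circle_measure)"
    by (rule integral_complex_of_real)
  finally have \<mu>: "\<mu> b = (\<integral>z. Re (\<psi> z) * (norm (b z))\<^sup>2 \<partial>circle_measure)"
    using of_real_eq_iff by blast
  have int: "integrable circle_measure (\<lambda>z. Re (\<psi> z) * (norm (b z))\<^sup>2)"
  proof -
    have "integrable circle_measure (\<lambda>z. \<psi> z * b z * cnj (b z))"
      by (intro L2_inner_integrable L2_mult_continuous bL2 \<psi>_continuous)
    then have "integrable circle_measure (\<lambda>z. Re (\<psi> z * b z * cnj (b z)))"
      by (rule integrable_Re)
    also have "(\<lambda>z. Re (\<psi> z * b z * cnj (b z))) = (\<lambda>z. Re (\<psi> z) * (norm (b z))\<^sup>2)"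
      by (auto simp: fun_eq_iff mult.assoc complex_mult_cnj cmod_power2)
    finally show ?thesis .
  qed
  have "(\<integral>z. x * (norm (b z))\<^sup>2 \<partial>circle_measure) \<le> \<mu> b"
    unfolding \<mu> using int bounds L2_sq_integrable[OF bL2]
    by (intro integral_mono mult_right_mono) auto
  moreover have "\<mu> b \<le> (\<integral>z. y * (norm (b z))\<^sup>2 \<partial>circle_measure)"
    unfolding \<mu> using int bounds L2_sq_integrable[OF bL2]
    by (intro integral_mono mult_right_mono) auto
  ultimately show ?thesis
    by (simp add: norm_b)
qed

text \<open>
  If multiplication by \<open>\<psi> - c\<close> nearly annihilates \<open>k\<close>, then the spectral measure of \<open>k\<close> is
  concentrated near \<open>c\<close>, by Chebyshev's inequality.
\<close>

lemma fun_calc_approx: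
  assumes k: "k \<in> K" and bounds: "\<And>z. norm z = 1 \<Longrightarrow> Re (\<psi> z) \<in> {x..y}" and c: "c \<in> {x..y}"
    and g: "\<And>s. s \<in> {x..y} \<Longrightarrow> norm (g s) \<le> G"
    and unif: "\<And>s. s \<in> {x..y} \<Longrightarrow> \<bar>s - c\<bar> < d \<Longrightarrow> norm (g s - g c) \<le> \<eta>"
    and pos: "d > 0" "\<eta> \<ge> 0" "G \<ge> 0" "\<delta> \<ge> 0"
    and \<delta>: "L2_norm (\<lambda>z. (\<psi> z - complex_of_real c) * k z) \<le> \<delta> * L2_norm k"
  shows "norm (L2_inner (L2_fun_calc K (compression \<psi>) g k) k - g c * (L2_norm k)\<^sup>2)
    \<le> (\<eta> + 2 * G * \<delta>\<^sup>2 / d\<^sup>2) * (L2_norm k)\<^sup>2"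
proof -
  let ?a = "\<lambda>b. (norm (L2_inner k b))\<^sup>2"
  let ?N = "(L2_norm k)\<^sup>2"
  have a: "L2_inner k b * L2_inner b k = of_real (?a b)" for b
    by (subst (2) L2_inner_commute) (simp only: complex_norm_square)
  have N: "?N = (\<Sum>b\<in>F. ?a b)"
    by (rule Parseval_norm[OF k])
  have kL2: "k \<in> L2" "(\<lambda>z. \<psi> z * k z) \<in> L2" "(\<lambda>z. of_real c * k z) \<in> L2"
    using in_L2[OF k] \<psi>_continuous by (auto intro: L2_mult_continuous L2_scale)
  have "(\<Sum>b\<in>F. (\<mu> b - c)\<^sup>2 * ?a b) \<le> (\<delta> * L2_norm k)\<^sup>2"
  proof -
    let ?h = "\<lambda>z. (\<psi> z - complex_of_real c) * k z"
    have h: "?h \<in> L2"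
      using L2_diff[OF kL2(2,3)] by (simp add: left_diff_distrib)
    have "L2_inner ?h b = of_real (\<mu> b - c) * L2_inner k b" if "b \<in> F" for b
    proof -
      have "L2_inner ?h b = L2_inner (\<lambda>z. \<psi> z * k z) b - L2_inner (\<lambda>z. of_real c * k z) b"
        using L2_inner_diff_left[OF kL2(2,3), of b] that E_L2 by (auto simp: left_diff_distrib)
      then show ?thesis
        unfolding inner_mult_F[OF k that] L2_inner_scale_left by (simp add: left_diff_distrib)
    qed
    then have "(norm (L2_inner ?h b))\<^sup>2 = (\<mu> b - c)\<^sup>2 * ?a b" if "b \<in> F" for b
      using that by (simp only: norm_mult norm_of_real power_mult_distrib power2_abs)
    then have "(\<Sum>b\<in>F. (\<mu> b - c)\<^sup>2 * ?a b) = (\<Sum>b\<in>F. (norm (L2_inner ?h b))\<^sup>2)"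
      by (intro sum.cong) auto
    also have "\<dots> \<le> (L2_norm ?h)\<^sup>2"
      by (rule L2_Bessel[OF finite_E E_L2 E_orthonormal h])
    also have "\<dots> \<le> (\<delta> * L2_norm k)\<^sup>2"
      using \<delta> by (intro power_mono) auto
    finally show ?thesis .
  qed
  then have cheb: "(\<Sum>b\<in>F. (\<mu> b - c)\<^sup>2 * ?a b) \<le> \<delta>\<^sup>2 * ?N"
    by (simp add: power_mult_distrib)
  have pointwise: "norm (g (\<mu> b) - g c) \<le> \<eta> + 2 * G / d\<^sup>2 * (\<mu> b - c)\<^sup>2" if "b \<in> F" for b
  proof (cases "\<bar>\<mu> b - c\<bar> < d")
    case True
    have "norm (g (\<mu> b) - g c) \<le> \<eta>"
      by (rule unif[OF eigenvalue_bounds[OF that bounds] True])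
    also have "\<dots> \<le> \<eta> + 2 * G / d\<^sup>2 * (\<mu> b - c)\<^sup>2"
      using pos by simp
    finally show ?thesis .
  next
    case False
    have "norm (g (\<mu> b) - g c) \<le> G + G"
      using g[OF eigenvalue_bounds[OF that bounds]] g[OF c] by (intro norm_triangle_le_diff add_mono)
    also have "\<dots> \<le> 2 * G / d\<^sup>2 * (\<mu> b - c)\<^sup>2"
    proof -
      have "d\<^sup>2 \<le> \<bar>\<mu> b - c\<bar>\<^sup>2"
        using False pos by (intro power_mono) auto
      then have "2 * G / d\<^sup>2 * d\<^sup>2 \<le> 2 * G / d\<^sup>2 * (\<mu> b - c)\<^sup>2"
        using pos by (intro mult_left_mono) auto
      then show ?thesis
        using pos by simp
    qed
    finally show ?thesis
      using pos by simp
  qed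
  have "L2_inner (L2_fun_calc K (compression \<psi>) g k) k - g c * ?N
      = (\<Sum>b\<in>F. (g (\<mu> b) - g c) * of_real (?a b))"
    unfolding inner_fun_calc[OF k kL2(1)] a N of_real_sum
    by (simp only: sum_distrib_left sum_subtractf left_diff_distrib)
  also have "norm \<dots> \<le> (\<Sum>b\<in>F. norm ((g (\<mu> b) - g c) * of_real (?a b)))"
    by (rule norm_sum)
  also have "\<dots> \<le> (\<Sum>b\<in>F. (\<eta> + 2 * G / d\<^sup>2 * (\<mu> b - c)\<^sup>2) * ?a b)"
    using pointwise by (intro sum_mono) (simp add: norm_mult norm_power mult_right_mono)
  also have "\<dots> = \<eta> * ?N + 2 * G / d\<^sup>2 * (\<Sum>b\<in>F. (\<mu> b - c)\<^sup>2 * ?a b)"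
    unfolding N by (simp only: distrib_right sum.distrib sum_distrib_left mult.assoc)
  also have "\<dots> \<le> \<eta> * ?N + 2 * G / d\<^sup>2 * (\<delta>\<^sup>2 * ?N)"
    using cheb pos by (intro add_left_mono mult_left_mono) auto
  also have "\<dots> = (\<eta> + 2 * G * \<delta>\<^sup>2 / d\<^sup>2) * ?N"
    by (simp add: algebra_simps)
  finally show ?thesis .
qed

end

section \<open>The Hardy space and Blaschke factors\<close>

lemma hardy2_L2: "f \<in> hardy2 \<Longrightarrow> f \<in> L2"
  by (simp add: hardy2_def)

lemma hardy2_integral: "f \<in> hardy2 \<Longrightarrow> k \<ge> 1 \<Longrightarrow> (\<integral>z. f z * z ^ k \<partial>circle_measure) = 0"
  by (simp add: hardy2_def)

lemma hardy2_integral_shift: "f \<in> hardy2 \<Longrightarrow> (\<integral>z. z * f z \<partial>circle_measure) = 0"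
  using hardy2_integral[of f 1] by (simp add: mult.commute)

lemma L2_mult_power: "f \<in> L2 \<Longrightarrow> (\<lambda>z. f z * z ^ k) \<in> L2"
  using L2_mult_continuous[of f "\<lambda>z. z ^ k"] by (simp add: mult.commute continuous_intros)

lemma hardy2_const: "(\<lambda>z. c) \<in> hardy2"
  using integral_circle_power by (auto simp: hardy2_def intro: L2_continuous)

lemma hardy2_add: "f \<in> hardy2 \<Longrightarrow> g \<in> hardy2 \<Longrightarrow> (\<lambda>z. f z + g z) \<in> hardy2"
  using L2_integrable[OF L2_mult_power] by (auto simp: hardy2_def distrib_right L2_add)

lemma hardy2_scale: "f \<in> hardy2 \<Longrightarrow> (\<lambda>z. c * f z) \<in> hardy2"
  by (auto simp: hardy2_def mult.assoc L2_scale)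

lemma hardy2_diff: "f \<in> hardy2 \<Longrightarrow> g \<in> hardy2 \<Longrightarrow> (\<lambda>z. f z - g z) \<in> hardy2"
  using hardy2_add[of f "\<lambda>z. (-1) * g z"] hardy2_scale[of g "-1"] by simp

lemma hardy2_sum: "(\<And>i. i \<in> I \<Longrightarrow> f i \<in> hardy2) \<Longrightarrow> (\<lambda>z. \<Sum>i\<in>I. c i * f i z) \<in> hardy2"
  by (induction I rule: infinite_finite_induct) (auto intro!: hardy2_const hardy2_add hardy2_scale)

lemma hardy2_shift: "f \<in> hardy2 \<Longrightarrow> (\<lambda>z. z * f z) \<in> hardy2"
  using hardy2_integral[of f "Suc _"] L2_mult_power[of f 1]
  by (auto simp: hardy2_def mult_ac)

lemma one_minus_cnj_mult_nonzero:
  assumes "norm a < 1" "norm z = 1"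
  shows "1 - cnj a * z \<noteq> 0"
proof
  assume "1 - cnj a * z = 0"
  then have "norm (cnj a * z) = 1" by simp
  then show False using assms by (simp add: norm_mult)
qed

lemma circle_minus_nonzero: "norm a < 1 \<Longrightarrow> norm z = 1 \<Longrightarrow> z - a \<noteq> 0"
  by auto

lemma cnj_circle: "norm z = 1 \<Longrightarrow> cnj z = inverse z" for z :: complex
  by (metis complex_norm_square inverse_unique mult.commute of_real_1 one_power2)

lemma cnj_one_minus_cnj_mult:
  assumes "norm z = 1"
  shows "cnj (1 - cnj a * z) = (z - a) / z"
proof -
  have "z \<noteq> 0"
    using assms by auto
  then show ?thesis
    by (simp add: cnj_circle[OF assms] divide_inverse left_diff_distrib)
qed

lemma continuous_on_inverse_one_minus:
  assumes "norm a < 1"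
  shows "continuous_on (sphere 0 1) (\<lambda>z. inverse (1 - cnj a * z))"
  using one_minus_cnj_mult_nonzero[OF assms] by (intro continuous_intros) auto

text \<open>
  The moments \<open>I\<^sub>k = \<integral> f z\<^sup>k / (1 - cnj a z)\<close> satisfy \<open>I\<^sub>k = cnj a \<cdot> I\<^sub>k\<^sub>+\<^sub>1\<close> for positive \<open>k\<close>; being
  bounded, they vanish.
\<close>

lemma hardy2_Cauchy_kernel:
  assumes a: "norm a < 1" and f: "f \<in> hardy2"
  shows "(\<lambda>z. inverse (1 - cnj a * z) * f z) \<in> hardy2"
proof -
  let ?g = "\<lambda>z. inverse (1 - cnj a * z) * f z"
  define I where "I k = (\<integral>z. ?g z * z ^ k \<partial>circle_measure)" for k
  have g: "?g \<in> L2"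
    by (intro L2_mult_continuous hardy2_L2 f continuous_on_inverse_one_minus a)
  have int: "integrable circle_measure (\<lambda>z. ?g z * z ^ k)" for k
    by (intro L2_integrable L2_mult_power g)
  have step: "I k = cnj a * I (Suc k)" if "k \<ge> 1" for k
  proof -
    have "I k - cnj a * I (Suc k) = (\<integral>z. ?g z * z ^ k - cnj a * (?g z * z ^ Suc k) \<partial>circle_measure)"
      unfolding I_def
      by (subst Bochner_Integration.integral_diff, rule int, rule integrable_mult_right, rule int)
         (simp only: integral_mult_right_zero)
    also have "\<dots> = (\<integral>z. f z * z ^ k \<partial>circle_measure)"
    proof (intro Bochner_Integration.integral_cong refl)
      fix z assume "z \<in> space circle_measure"
      then have "1 - cnj a * z \<noteq> 0"
        using one_minus_cnj_mult_nonzero[OF a] by simp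
      moreover have "u * f z * z ^ k - cnj a * (u * f z * z ^ Suc k) = u * (1 - cnj a * z) * (f z * z ^ k)" for u
        by (simp add: algebra_simps)
      ultimately show "?g z * z ^ k - cnj a * (?g z * z ^ Suc k) = f z * z ^ k"
        by simp
    qed
    also have "\<dots> = 0"
      by (rule hardy2_integral[OF f that])
    finally show ?thesis by simp
  qed
  have iter: "I k = cnj a ^ m * I (k + m)" if "k \<ge> 1" for k m
  proof (induction m)
    case (Suc m)
    then show ?case using step[of "k + m"] that by simp
  qed simp
  have bound: "norm (I k) \<le> (\<integral>z. norm (?g z) \<partial>circle_measure)" for k
  proof -
    have "norm (I k) \<le> (\<integral>z. norm (?g z * z ^ k) \<partial>circle_measure)"
      unfolding I_def by (rule integral_norm_bound)
    also have "\<dots> = (\<integral>z. norm (?g z) \<partial>circle_measure)"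
      by (intro Bochner_Integration.integral_cong) (auto simp: norm_mult norm_power)
    finally show ?thesis .
  qed
  have "I k = 0" if "k \<ge> 1" for k
  proof -
    have "(\<lambda>m. norm a ^ m * (\<integral>z. norm (?g z) \<partial>circle_measure)) \<longlonglongrightarrow> 0 * (\<integral>z. norm (?g z) \<partial>circle_measure)"
      using a by (intro tendsto_intros LIMSEQ_power_zero) auto
    moreover have "norm (I k) \<le> norm a ^ m * (\<integral>z. norm (?g z) \<partial>circle_measure)" for m
    proof -
      have "norm (I k) = norm a ^ m * norm (I (k + m))"
        by (subst iter[OF that, of m]) (simp add: norm_mult norm_power)
      then show ?thesis
        by (simp only:) (intro mult_left_mono bound, simp)
    qed
    ultimately have "norm (I k) \<le> 0"
      by (intro LIMSEQ_le_const) auto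
    then show ?thesis by simp
  qed
  then show ?thesis
    using g by (simp add: hardy2_def I_def)
qed

lemma hardy2_blaschke_factor:
  assumes "norm a < 1" "f \<in> hardy2"
  shows "(\<lambda>z. blaschke_factor a z * f z) \<in> hardy2"
proof -
  let ?g = "\<lambda>z. inverse (1 - cnj a * z) * f z"
  have "(\<lambda>z. z * ?g z - a * ?g z) \<in> hardy2"
    by (intro hardy2_diff hardy2_shift hardy2_scale hardy2_Cauchy_kernel assms)
  also have "(\<lambda>z. z * ?g z - a * ?g z) = (\<lambda>z. blaschke_factor a z * f z)"
    by (auto simp: blaschke_factor_def fun_eq_iff divide_inverse algebra_simps)
  finally show ?thesis .
qed

text \<open>
  The hypothesis says that the analytic extension of \<open>f\<close> vanishes at \<open>a\<close>.
\<close>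

lemma hardy2_divide_blaschke_factor:
  assumes a: "norm a < 1" and f: "f \<in> hardy2"
    and zero: "L2_inner f (\<lambda>z. inverse (1 - cnj a * z)) = 0"
  shows "(\<lambda>z. inverse (blaschke_factor a z) * f z) \<in> hardy2"
proof -
  \<comment> \<open>Moments of \<open>f / (z - a)\<close>; the first one vanishes by hypothesis, and each is \<open>a\<close> times the one
     before.\<close>
  define J where "J k = (\<integral>z. inverse (z - a) * f z * z ^ Suc k \<partial>circle_measure)" for k
  have cont: "continuous_on (sphere 0 1) (\<lambda>z. inverse (z - a))"
    using circle_minus_nonzero[OF a] by (intro continuous_intros) auto
  have int: "integrable circle_measure (\<lambda>z. inverse (z - a) * f z * z ^ k)" for k
    by (intro L2_integrable L2_mult_power L2_mult_continuous hardy2_L2 f cont)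
  have "J 0 = L2_inner f (\<lambda>z. inverse (1 - cnj a * z))"
    unfolding J_def L2_inner_def
  proof (intro Bochner_Integration.integral_cong refl)
    fix z :: complex assume "z \<in> space circle_measure"
    then have "cnj (inverse (1 - cnj a * z)) = z * inverse (z - a)"
      using cnj_one_minus_cnj_mult[of z a] by (simp add: divide_inverse mult.commute)
    then show "inverse (z - a) * f z * z ^ Suc 0 = f z * cnj (inverse (1 - cnj a * z))"
      by (simp add: mult_ac)
  qed
  then have J0: "J 0 = 0"
    using zero by simp
  have step: "J (Suc k) = a * J k" for k
  proof -
    have "J (Suc k) - a * J k
        = (\<integral>z. inverse (z - a) * f z * z ^ Suc (Suc k) - a * (inverse (z - a) * f z * z ^ Suc k) \<partial>circle_measure)"
      unfolding J_def
      by (subst Bochner_Integration.integral_diff, rule int, rule integrable_mult_right, rule int)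
         (simp only: integral_mult_right_zero)
    also have "\<dots> = (\<integral>z. f z * z ^ Suc k \<partial>circle_measure)"
    proof (intro Bochner_Integration.integral_cong refl)
      fix z assume "z \<in> space circle_measure"
      then have nz: "z - a \<noteq> 0"
        using circle_minus_nonzero[OF a] by simp
      have "u * f z * z ^ Suc (Suc k) - a * (u * f z * z ^ Suc k) = u * (z - a) * (f z * z ^ Suc k)" for u
        by (simp add: algebra_simps)
      then show "inverse (z - a) * f z * z ^ Suc (Suc k) - a * (inverse (z - a) * f z * z ^ Suc k) = f z * z ^ Suc k"
        by (simp only: left_inverse[OF nz] mult_1)
    qed
    also have "\<dots> = 0"
      by (rule hardy2_integral[OF f]) simp
    finally show ?thesis by simp
  qed
  have J: "J k = 0" for k
    by (induction k) (simp_all add: J0 step)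
  have "(\<integral>z. inverse (blaschke_factor a z) * f z * z ^ k \<partial>circle_measure) = 0" if "k \<ge> 1" for k
  proof -
    from that obtain m where m: "k = Suc m"
      by (cases k) auto
    have "(\<integral>z. inverse (blaschke_factor a z) * f z * z ^ k \<partial>circle_measure)
        = (\<integral>z. inverse (z - a) * f z * z ^ Suc m - cnj a * (inverse (z - a) * f z * z ^ Suc (Suc m)) \<partial>circle_measure)"
      unfolding m blaschke_factor_def inverse_divide by (simp add: divide_inverse algebra_simps)
    also have "\<dots> = J m - cnj a * J (Suc m)"
      unfolding J_def
      by (subst Bochner_Integration.integral_diff, rule int, rule integrable_mult_right, rule int)
         (simp only: integral_mult_right_zero)
    finally show ?thesis
      by (simp add: J)
  qed
  moreover have "(\<lambda>z. inverse (blaschke_factor a z) * f z) \<in> L2"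
  proof (intro L2_mult_continuous hardy2_L2 f)
    show "continuous_on (sphere 0 1) (\<lambda>z. inverse (blaschke_factor a z))"
      unfolding blaschke_factor_def inverse_divide
      using circle_minus_nonzero[OF a] by (intro continuous_intros) auto
  qed
  ultimately show ?thesis
    by (simp add: hardy2_def)
qed

lemma norm_blaschke_factor:
  assumes "norm a < 1" "norm z = 1"
  shows "norm (blaschke_factor a z) = 1"
proof -
  have "norm (1 - cnj a * z) = norm (cnj (1 - cnj a * z))"
    by (simp only: complex_mod_cnj)
  also have "\<dots> = norm (z - a)"
    by (simp only: cnj_one_minus_cnj_mult[OF assms(2)] norm_divide assms(2) div_by_1)
  finally show ?thesis
    using circle_minus_nonzero[OF assms] by (simp add: blaschke_factor_def norm_divide)
qed

lemma L2_inner_Cauchy_kernel_self: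
  assumes a: "norm a < 1"
  shows "L2_inner (\<lambda>z. inverse (1 - cnj a * z)) (\<lambda>z. inverse (1 - cnj a * z)) = 1 / (1 - (norm a)\<^sup>2)"
proof -
  let ?u = "\<lambda>z. inverse (1 - cnj a * z)"
  have u: "?u \<in> hardy2"
    using hardy2_Cauchy_kernel[OF a hardy2_const[of 1]] by simp
  \<comment> \<open>Everything follows from \<open>u = 1 + cnj a z u\<close>, in which \<open>z u\<close> is orthogonal to \<open>1\<close> and has the
     same norm as \<open>u\<close>.\<close>
  have u1: "L2_inner ?u (\<lambda>z. 1) = 1"
  proof -
    have "L2_inner ?u (\<lambda>z. 1) = (\<integral>z. 1 + cnj a * (z * ?u z) \<partial>circle_measure)"
      unfolding L2_inner_def
    proof (intro Bochner_Integration.integral_cong refl)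
      fix z assume "z \<in> space circle_measure"
      then have "1 - cnj a * z \<noteq> 0"
        using one_minus_cnj_mult_nonzero[OF a] by simp
      then show "?u z * cnj 1 = 1 + cnj a * (z * ?u z)"
        by (simp add: field_simps)
    qed
    also have "\<dots> = 1 + cnj a * (\<integral>z. z * ?u z \<partial>circle_measure)"
      using L2_integrable[OF hardy2_L2[OF hardy2_shift[OF u]]] by simp
    finally show ?thesis
      using hardy2_integral_shift[OF u] by simp
  qed
  have zu: "L2_inner (\<lambda>z. z * ?u z) (\<lambda>z. z * ?u z) = L2_inner ?u ?u"
    unfolding L2_inner_def
  proof (intro Bochner_Integration.integral_cong refl)
    fix z assume "z \<in> space circle_measure"
    then have "z * cnj z = 1"
      using complex_norm_square[of z] by simp
    then show "z * ?u z * cnj (z * ?u z) = ?u z * cnj (?u z)"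
      by (metis (no_types, lifting) complex_cnj_mult mult.assoc mult.left_commute mult_1)
  qed
  have one_zu: "L2_inner (\<lambda>z. z * ?u z) (\<lambda>z. 1) = 0"
    using hardy2_integral_shift[OF u] by (simp add: L2_inner_def)
  have expand: "L2_inner ?u g = L2_inner (\<lambda>z. 1) g + cnj a * L2_inner (\<lambda>z. z * ?u z) g" if "g \<in> L2" for g
  proof -
    have "L2_inner ?u g = L2_inner (\<lambda>z. 1 + cnj a * (z * ?u z)) g"
      unfolding L2_inner_def
    proof (intro Bochner_Integration.integral_cong refl)
      fix z assume "z \<in> space circle_measure"
      then have "1 - cnj a * z \<noteq> 0"
        using one_minus_cnj_mult_nonzero[OF a] by simp
      then show "?u z * cnj (g z) = (1 + cnj a * (z * ?u z)) * cnj (g z)"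
        by (simp add: field_simps)
    qed
    also have "\<dots> = L2_inner (\<lambda>z. 1) g + L2_inner (\<lambda>z. cnj a * (z * ?u z)) g"
      by (intro L2_inner_add_left hardy2_L2 hardy2_const hardy2_scale hardy2_shift u that)
    finally show ?thesis
      by (simp add: L2_inner_scale_left)
  qed
  have "L2_inner ?u (\<lambda>z. z * ?u z) = cnj a * L2_inner ?u ?u"
    using expand[OF hardy2_L2[OF hardy2_shift[OF u]]] zu one_zu cnj_L2_inner[of "\<lambda>z. z * ?u z" "\<lambda>z. 1"] by simp
  moreover have "L2_inner (\<lambda>z. z * ?u z) ?u = cnj (L2_inner ?u (\<lambda>z. z * ?u z))"
    by simp
  ultimately have "L2_inner (\<lambda>z. z * ?u z) ?u = a * L2_inner ?u ?u"
    by simp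
  moreover have "L2_inner (\<lambda>z. 1) ?u = 1"
    using u1 cnj_L2_inner[of ?u "\<lambda>z. 1"] by simp
  ultimately have "L2_inner ?u ?u = 1 + cnj a * (a * L2_inner ?u ?u)"
    using expand[OF hardy2_L2[OF u]] by simp
  then have "L2_inner ?u ?u * (1 - cnj a * a) = 1"
    by (simp add: algebra_simps)
  moreover have "cnj a * a = of_real ((norm a)\<^sup>2)"
    by (simp add: complex_norm_square mult.commute del: of_real_power)
  ultimately have "L2_inner ?u ?u * of_real (1 - (norm a)\<^sup>2) = 1"
    by simp
  moreover have "1 - (norm a)\<^sup>2 \<noteq> 0"
    using a by (smt (verit) norm_ge_zero power2_eq_1_iff)
  ultimately show ?thesis
    by (simp only: of_real_divide of_real_1 eq_divide_eq of_real_eq_0_iff) simp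
qed

section \<open>Takenaka--Malmquist bases of model spaces\<close>

definition blaschke_phase :: "complex \<Rightarrow> complex" where
  "blaschke_phase a = (if a = 0 then - 1 else - (of_real (norm a) / a))"

lemma norm_blaschke_phase [simp]: "norm (blaschke_phase a) = 1"
  by (simp add: blaschke_phase_def norm_divide)

lemma blaschke_prod_0 [simp]: "blaschke_prod l 0 z = 1"
  by (simp add: blaschke_prod_def)

lemma blaschke_prod_Suc:
  "blaschke_prod l (Suc n) z
     = blaschke_prod l n z * (blaschke_phase (l (Suc n)) * blaschke_factor (l (Suc n)) z)"
  unfolding blaschke_prod_def blaschke_phase_def by simp

definition takenaka_malmquist :: "(nat \<Rightarrow> complex) \<Rightarrow> nat \<Rightarrow> complex \<Rightarrow> complex" where
  "takenaka_malmquist l k z =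
     blaschke_prod l k z * (of_real (sqrt (1 - (norm (l (Suc k)))\<^sup>2)) * inverse (1 - cnj (l (Suc k)) * z))"

lemma model_space_L2: "model_space B \<subseteq> L2"
  by (auto simp: model_space_def hardy2_def)

lemma model_space_zero: "(\<lambda>z. 0) \<in> model_space B"
  by (auto simp: model_space_def hardy2_const L2_inner_def)

lemma model_space_scale: "f \<in> model_space B \<Longrightarrow> (\<lambda>z. c * f z) \<in> model_space B"
  by (auto simp: model_space_def hardy2_scale L2_inner_scale_left)

lemma model_space_add:
  assumes "continuous_on (sphere 0 1) B" "f \<in> model_space B" "g \<in> model_space B"
  shows "(\<lambda>z. f z + g z) \<in> model_space B"
  using assms L2_inner_add_left[OF hardy2_L2 hardy2_L2 L2_mult_continuous[OF hardy2_L2]]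
  by (auto simp: model_space_def hardy2_add)

locale blaschke_sequence =
  fixes l :: "nat \<Rightarrow> complex"
  assumes l_in_disc: "\<And>j. j \<ge> 1 \<Longrightarrow> norm (l j) < 1"
begin

abbreviation B where "B \<equiv> blaschke_prod l"
abbreviation e where "e \<equiv> takenaka_malmquist l"

lemma l_Suc: "norm (l (Suc k)) < 1"
  by (rule l_in_disc) simp

lemma l_Suc_pos: "1 - (norm (l (Suc k)))\<^sup>2 > 0"
  using l_Suc[of k] by (simp add: abs_square_less_1)

lemma norm_B: "norm z = 1 \<Longrightarrow> norm (B n z) = 1"
  by (induction n) (auto simp: blaschke_prod_Suc norm_mult norm_blaschke_factor l_Suc)

lemma continuous_on_B: "continuous_on (sphere 0 1) (B n)"
proof (induction n)
  case (Suc n)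
  have "continuous_on (sphere 0 1) (blaschke_factor (l (Suc n)))"
    unfolding blaschke_factor_def[abs_def] using one_minus_cnj_mult_nonzero[OF l_Suc]
    by (intro continuous_intros) auto
  with Suc show ?case
    unfolding blaschke_prod_Suc[abs_def] by (intro continuous_intros)
qed (simp add: blaschke_prod_0[abs_def])

lemma continuous_on_e: "continuous_on (sphere 0 1) (e k)"
  unfolding takenaka_malmquist_def[abs_def]
  by (intro continuous_intros continuous_on_B continuous_on_inverse_one_minus l_Suc)

text \<open>
  The factors of \<open>B\<^sub>n\<close> beyond the first \<open>j\<close> are absorbed into the Hardy space function.
\<close>

lemma hardy2_B_mult_split:
  assumes "j \<le> n" "h \<in> hardy2"
  shows "\<exists>g\<in>hardy2. \<forall>z. B n z * h z = B j z * g z"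
  using assms
proof (induction n arbitrary: h rule: dec_induct)
  case base
  then show ?case by auto
next
  case (step n)
  let ?a = "l (Suc n)"
  have "(\<lambda>z. blaschke_phase ?a * (blaschke_factor ?a z * h z)) \<in> hardy2"
    by (intro hardy2_scale hardy2_blaschke_factor l_Suc step.prems)
  from step.IH[OF this] show ?case
    by (simp add: blaschke_prod_Suc mult.assoc)
qed

lemma hardy2_B_mult: "h \<in> hardy2 \<Longrightarrow> (\<lambda>z. B n z * h z) \<in> hardy2"
  using hardy2_B_mult_split[of 0 n h] by (auto simp: fun_eq_iff[symmetric])

lemma e_eq_B_mult:
  obtains h where "h \<in> hardy2" "e k = (\<lambda>z. B k z * h z)"
proof
  show "(\<lambda>z. of_real (sqrt (1 - (norm (l (Suc k)))\<^sup>2)) * (inverse (1 - cnj (l (Suc k)) * z) * 1)) \<in> hardy2"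
    by (intro hardy2_scale hardy2_Cauchy_kernel hardy2_const l_Suc)
qed (simp add: takenaka_malmquist_def fun_eq_iff)

lemma e_hardy2: "e k \<in> hardy2"
proof -
  obtain h where "h \<in> hardy2" "e k = (\<lambda>z. B k z * h z)"
    by (rule e_eq_B_mult)
  then show ?thesis
    by (simp add: hardy2_B_mult)
qed

text \<open>
  On the circle \<open>B\<^sub>k\<close> is unimodular and drops out of an inner product in which it occurs twice.
\<close>

lemma L2_inner_B_mult_e:
  "L2_inner (\<lambda>z. B k z * h z) (e k)
     = of_real (sqrt (1 - (norm (l (Suc k)))\<^sup>2)) * L2_inner h (\<lambda>z. inverse (1 - cnj (l (Suc k)) * z))"
proof -
  let ?s = "complex_of_real (sqrt (1 - (norm (l (Suc k)))\<^sup>2))"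
  let ?u = "\<lambda>z. inverse (1 - cnj (l (Suc k)) * z)"
  have "L2_inner (\<lambda>z. B k z * h z) (e k) = (\<integral>z. ?s * (h z * cnj (?u z)) \<partial>circle_measure)"
    unfolding L2_inner_def
  proof (intro Bochner_Integration.integral_cong refl)
    fix z assume "z \<in> space circle_measure"
    then have "B k z * cnj (B k z) = 1"
      using norm_B[of z k] by (simp flip: complex_norm_square)
    moreover have "B k z * h z * cnj (e k z) = (B k z * cnj (B k z)) * (?s * (h z * cnj (?u z)))"
      by (simp add: takenaka_malmquist_def mult_ac)
    ultimately show "B k z * h z * cnj (e k z) = ?s * (h z * cnj (?u z))"
      by simp
  qed
  then show ?thesis
    by (simp add: L2_inner_def)
qed

text \<open>
  After cancellation of \<open>B\<^sub>k\<close> the inner product is the evaluation at the zero of the next Blaschke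
  factor, which is still present since \<open>k < n\<close>.
\<close>

lemma e_orthogonal_B_mult:
  assumes "k < n" "h \<in> hardy2"
  shows "L2_inner (\<lambda>z. B n z * h z) (e k) = 0"
proof -
  let ?a = "l (Suc k)"
  obtain g where g: "g \<in> hardy2" "\<And>z. B n z * h z = B (Suc k) z * g z"
    using hardy2_B_mult_split[of "Suc k" n h] assms by auto
  let ?h = "\<lambda>z. blaschke_phase ?a * (blaschke_factor ?a z * g z)"
  have "(\<lambda>z. B n z * h z) = (\<lambda>z. B k z * ?h z)"
    by (simp add: g blaschke_prod_Suc mult.assoc)
  then have "L2_inner (\<lambda>z. B n z * h z) (e k)
      = of_real (sqrt (1 - (norm ?a)\<^sup>2)) * L2_inner ?h (\<lambda>z. inverse (1 - cnj ?a * z))"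
    by (simp only: L2_inner_B_mult_e)
  also have "L2_inner ?h (\<lambda>z. inverse (1 - cnj ?a * z))
      = (\<integral>z. blaschke_phase ?a * (z * (inverse (1 - cnj ?a * z) * g z)) \<partial>circle_measure)"
    unfolding L2_inner_def
  proof (intro Bochner_Integration.integral_cong refl)
    fix z assume "z \<in> space circle_measure"
    then have z: "norm z = 1" by simp
    have "cnj (inverse (1 - cnj ?a * z)) = z / (z - ?a)"
      unfolding complex_cnj_inverse cnj_one_minus_cnj_mult[OF z] by simp
    then show "?h z * cnj (inverse (1 - cnj ?a * z))
        = blaschke_phase ?a * (z * (inverse (1 - cnj ?a * z) * g z))"
      using circle_minus_nonzero[OF l_Suc z, of k] by (simp add: blaschke_factor_def divide_inverse)
  qed
  also have "\<dots> = 0"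
    using hardy2_integral_shift[OF hardy2_Cauchy_kernel[OF l_Suc g(1)], of k] by simp
  finally show ?thesis by simp
qed

lemma e_orthonormal: "L2_inner (e j) (e k) = (if j = k then 1 else 0)"
proof -
  have less: "L2_inner (e j) (e k) = 0" if "k < j" for j k
  proof -
    obtain h where "h \<in> hardy2" "e j = (\<lambda>z. B j z * h z)"
      by (rule e_eq_B_mult)
    then show ?thesis
      using e_orthogonal_B_mult[OF that] by simp
  qed
  have "L2_inner (e k) (e k) = 1"
  proof -
    let ?s = "complex_of_real (sqrt (1 - (norm (l (Suc k)))\<^sup>2))"
    let ?u = "\<lambda>z. inverse (1 - cnj (l (Suc k)) * z)"
    have "L2_inner (e k) (e k) = ?s * L2_inner (\<lambda>z. ?s * ?u z) ?u"
      using L2_inner_B_mult_e[of k "\<lambda>z. ?s * ?u z"] by (simp add: takenaka_malmquist_def[abs_def])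
    also have "\<dots> = of_real ((sqrt (1 - (norm (l (Suc k)))\<^sup>2))\<^sup>2 * (1 / (1 - (norm (l (Suc k)))\<^sup>2)))"
      unfolding L2_inner_scale_left L2_inner_Cauchy_kernel_self[OF l_Suc] power2_eq_square[of "sqrt _"]
        of_real_mult[of "_ * _"] of_real_mult[of "sqrt _"] by (simp only: mult.assoc)
    also have "\<dots> = 1"
      using l_Suc_pos[of k] by simp
    finally show ?thesis .
  qed
  moreover have "L2_inner (e j) (e k) = cnj (L2_inner (e k) (e j))"
    by simp
  ultimately show ?thesis
    using less[of k j] less[of j k] by (cases j k rule: linorder_cases) auto
qed

text \<open>
  Orthogonality to \<open>e\<^sub>k\<close> is the vanishing, at the zero of the next Blaschke factor, of what is
  left after division by \<open>B\<^sub>k\<close>.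
\<close>

lemma hardy2_divisible_by_B:
  assumes f: "f \<in> hardy2" and perp: "\<And>k. k < n \<Longrightarrow> L2_inner f (e k) = 0"
  shows "\<exists>h\<in>hardy2. \<forall>z. norm z = 1 \<longrightarrow> f z = B n z * h z"
  using perp
proof (induction n)
  case 0
  then show ?case using f by auto
next
  case (Suc n)
  let ?a = "l (Suc n)"
  obtain h where h: "h \<in> hardy2" "\<And>z. norm z = 1 \<Longrightarrow> f z = B n z * h z"
    using Suc by auto
  have "L2_inner f (e n) = L2_inner (\<lambda>z. B n z * h z) (e n)"
    unfolding L2_inner_def using h(2) by (intro Bochner_Integration.integral_cong) auto
  then have "L2_inner h (\<lambda>z. inverse (1 - cnj ?a * z)) = 0"
    using Suc.prems[of n] l_Suc_pos[of n] by (simp add: L2_inner_B_mult_e)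
  from hardy2_divide_blaschke_factor[OF l_Suc h(1) this]
  have "(\<lambda>z. inverse (blaschke_phase ?a) * (inverse (blaschke_factor ?a z) * h z)) \<in> hardy2"
    by (rule hardy2_scale)
  moreover have "f z = B (Suc n) z * (inverse (blaschke_phase ?a) * (inverse (blaschke_factor ?a z) * h z))"
    if "norm z = 1" for z
  proof -
    have "blaschke_phase ?a \<noteq> 0" "blaschke_factor ?a z \<noteq> 0"
      using norm_blaschke_factor[OF l_Suc that, of n] by (auto simp: blaschke_phase_def)
    then show ?thesis
      using h(2)[OF that] by (simp add: blaschke_prod_Suc field_simps)
  qed
  ultimately show ?case by auto
qed

lemma inj_e: "inj e"
  using e_orthonormal by (metis injI zero_neq_one)

lemma e_in_model_space: "k < n \<Longrightarrow> e k \<in> model_space (B n)"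
  using e_orthogonal_B_mult e_hardy2 by (auto simp: model_space_def simp flip: cnj_L2_inner[of _ "e k"])

lemma e_basis: "L2_orthonormal_basis (model_space (B n)) (e ` {..<n})"
proof -
  have "AE z in circle_measure. f z = (\<Sum>b\<in>e ` {..<n}. L2_inner f b * b z)"
    if f: "f \<in> model_space (B n)" for f
  proof -
    let ?s = "\<lambda>z. \<Sum>k<n. L2_inner f (e k) * e k z"
    let ?r = "\<lambda>z. f z - ?s z"
    have fH: "f \<in> hardy2"
      using f by (simp add: model_space_def)
    have sH: "?s \<in> hardy2"
      by (intro hardy2_sum e_hardy2)
    have rH: "?r \<in> hardy2"
      by (intro hardy2_diff fH sH)
    have s_inner: "L2_inner ?s h = (\<Sum>k<n. L2_inner f (e k) * L2_inner (e k) h)" if "h \<in> L2" for h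
      using that by (intro L2_inner_sum_left) (auto intro: hardy2_L2 e_hardy2)
    have "L2_inner ?r (e k) = 0" if "k < n" for k
      using that L2_inner_diff_left[OF hardy2_L2[OF fH] hardy2_L2[OF sH] hardy2_L2[OF e_hardy2]]
      by (simp add: s_inner[OF hardy2_L2[OF e_hardy2]] e_orthonormal if_distrib[of "(*) _"] cong: if_cong)
    then obtain h where h: "h \<in> hardy2" "\<And>z. norm z = 1 \<Longrightarrow> ?r z = B n z * h z"
      using hardy2_divisible_by_B[OF rH] by blast
    have BhL2: "(\<lambda>z. B n z * h z) \<in> L2"
      by (intro hardy2_L2 hardy2_B_mult h)
    have "L2_inner ?r ?r = L2_inner ?r (\<lambda>z. B n z * h z)"
      unfolding L2_inner_def[of _ ?r] L2_inner_def[of _ "\<lambda>z. B n z * h z"]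
    proof (intro Bochner_Integration.integral_cong refl)
      fix z assume "z \<in> space circle_measure"
      then have "?r z = B n z * h z"
        using h(2) by simp
      then show "?r z * cnj (?r z) = ?r z * cnj (B n z * h z)"
        by (simp only:)
    qed
    also have "\<dots> = L2_inner f (\<lambda>z. B n z * h z) - L2_inner ?s (\<lambda>z. B n z * h z)"
      by (intro L2_inner_diff_left hardy2_L2 fH sH hardy2_B_mult h)
    also have "L2_inner f (\<lambda>z. B n z * h z) = 0"
      using f h by (simp add: model_space_def)
    also have "L2_inner ?s (\<lambda>z. B n z * h z) = 0"
      using e_in_model_space h by (auto simp: s_inner[OF BhL2] model_space_def)
    finally have "L2_norm ?r = 0"
      by (simp add: L2_inner_self)
    then have "AE z in circle_measure. ?r z = 0"
      using L2_norm_eq_0[OF hardy2_L2[OF rH]] by simp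
    moreover have "(\<Sum>b\<in>e ` {..<n}. L2_inner f b * b z) = ?s z" for z
      using inj_e by (subst sum.reindex) (auto intro: inj_on_subset)
    ultimately show ?thesis
      by simp
  qed
  then show ?thesis
    using e_in_model_space inj_e by (auto simp: L2_orthonormal_basis_def e_orthonormal inj_eq)
qed

lemma L2_subspace_model_space: "L2_subspace (model_space (B n)) (e ` {..<n})"
  using model_space_L2 model_space_zero model_space_add[OF continuous_on_B] model_space_scale e_basis
  by unfold_locales

lemma norm_e_sq:
  assumes "norm z = 1"
  shows "(norm (e k z))\<^sup>2 = (1 - (norm (l (Suc k)))\<^sup>2) / (norm (1 - cnj (l (Suc k)) * z))\<^sup>2"
  using l_Suc_pos[of k] norm_B[OF assms, of k]
  by (simp add: takenaka_malmquist_def norm_mult norm_inverse power_mult_distrib power_inverse divide_inverse)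

text \<open>A Christoffel--Darboux formula: the sum over the basis telescopes.\<close>

lemma sum_cnj_e_mult_e:
  assumes "norm \<zeta> = 1" "norm z = 1"
  shows "(1 - cnj \<zeta> * z) * (\<Sum>k<n. cnj (e k \<zeta>) * e k z) = 1 - cnj (B n \<zeta>) * B n z"
proof (induction n)
  case (Suc n)
  let ?a = "l (Suc n)"
  let ?s = "complex_of_real (sqrt (1 - (norm ?a)\<^sup>2))"
  have s: "?s * ?s = 1 - cnj ?a * ?a"
  proof -
    have "?s * ?s = of_real (1 - (norm ?a)\<^sup>2)"
      using l_Suc_pos[of n] by (simp flip: of_real_mult)
    then show ?thesis
      by (simp add: complex_norm_square mult.commute del: of_real_power)
  qed
  have phase: "cnj (blaschke_phase ?a) * blaschke_phase ?a = 1"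
    using complex_norm_square[of "blaschke_phase ?a"] by (simp add: mult.commute)
  have nz: "1 - cnj ?a * z \<noteq> 0" "cnj (1 - cnj ?a * \<zeta>) \<noteq> 0"
    unfolding complex_cnj_zero_iff using one_minus_cnj_mult_nonzero[OF l_Suc] assms by auto
  have "(1 - cnj \<zeta> * z) * (cnj (e n \<zeta>) * e n z)
      = cnj (B n \<zeta>) * B n z * ((1 - cnj \<zeta> * z) * (?s * ?s) / (cnj (1 - cnj ?a * \<zeta>) * (1 - cnj ?a * z)))"
    by (simp add: takenaka_malmquist_def divide_inverse mult_ac)
  also have "(1 - cnj \<zeta> * z) * (?s * ?s) / (cnj (1 - cnj ?a * \<zeta>) * (1 - cnj ?a * z))
      = 1 - cnj (blaschke_factor ?a \<zeta>) * blaschke_factor ?a z"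
    unfolding s blaschke_factor_def complex_cnj_divide using nz
    by (simp add: divide_simps) (simp add: algebra_simps)
  also have "\<dots> = 1 - cnj (blaschke_phase ?a * blaschke_factor ?a \<zeta>) * (blaschke_phase ?a * blaschke_factor ?a z)"
    using phase by (simp add: mult_ac)
  finally have "(1 - cnj \<zeta> * z) * (cnj (e n \<zeta>) * e n z)
      = cnj (B n \<zeta>) * B n z - cnj (B (Suc n) \<zeta>) * B (Suc n) z"
    by (simp add: blaschke_prod_Suc algebra_simps)
  then show ?case
    using Suc by (simp add: distrib_left)
qed simp

text \<open>
  On the circle each Blaschke factor \<open>b\<close> with zero \<open>a\<close> has the logarithmic derivative
  \<open>cnj z (1 - \<bar>a\<bar>\<^sup>2) / \<bar>1 - cnj a z\<bar>\<^sup>2\<close>, in which the fraction is \<open>\<bar>e\<^sub>k(z)\<bar>\<^sup>2\<close> because \<open>B\<^sub>k\<close> is unimodular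
  there.
\<close>

lemma has_field_derivative_B:
  assumes "norm z = 1"
  shows "(B n has_field_derivative B n z * cnj z * of_real (\<Sum>k<n. (norm (e k z))\<^sup>2)) (at z)"
proof (induction n)
  case 0
  then show ?case by (simp add: blaschke_prod_0[abs_def])
next
  case (Suc n)
  let ?a = "l (Suc n)" and ?c = "blaschke_phase (l (Suc n))"
  have nz: "1 - cnj ?a * z \<noteq> 0" "z - ?a \<noteq> 0" "z \<noteq> 0"
    using one_minus_cnj_mult_nonzero[OF l_Suc assms] circle_minus_nonzero[OF l_Suc assms] assms by auto
  have D: "(blaschke_factor ?a has_field_derivative (1 - cnj ?a * ?a) / (1 - cnj ?a * z)\<^sup>2) (at z)"
    unfolding blaschke_factor_def[abs_def] using nz
    by (auto intro!: derivative_eq_intros simp: power2_eq_square field_simps)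
  have "of_real ((norm (e n z))\<^sup>2) = (1 - cnj ?a * ?a) / ((1 - cnj ?a * z) * cnj (1 - cnj ?a * z))"
    unfolding norm_e_sq[OF assms] of_real_divide complex_norm_square of_real_diff by (simp add: mult.commute)
  also have "\<dots> = (1 - cnj ?a * ?a) / ((1 - cnj ?a * z) * ((z - ?a) / z))"
    by (simp only: cnj_one_minus_cnj_mult[OF assms])
  finally have "blaschke_factor ?a z * cnj z * of_real ((norm (e n z))\<^sup>2)
      = (1 - cnj ?a * ?a) / (1 - cnj ?a * z)\<^sup>2"
  proof (simp only: cnj_circle[OF assms] blaschke_factor_def)
    have "t / d * inverse z * (w / (d * (t / z))) = w / d\<^sup>2" if "t \<noteq> 0" "d \<noteq> 0" for t d w
      using that nz(3) by (simp add: field_simps power2_eq_square)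
    then show "(z - ?a) / (1 - cnj ?a * z) * inverse z * ((1 - cnj ?a * ?a) / ((1 - cnj ?a * z) * ((z - ?a) / z)))
        = (1 - cnj ?a * ?a) / (1 - cnj ?a * z)\<^sup>2"
      using nz by blast
  qed
  with D have D': "(blaschke_factor ?a has_field_derivative
      blaschke_factor ?a z * cnj z * of_real ((norm (e n z))\<^sup>2)) (at z)"
    by simp
  have "((\<lambda>z. B n z * (?c * blaschke_factor ?a z)) has_field_derivative
      B n z * (?c * (blaschke_factor ?a z * cnj z * of_real ((norm (e n z))\<^sup>2)))
      + B n z * cnj z * of_real (\<Sum>k<n. (norm (e k z))\<^sup>2) * (?c * blaschke_factor ?a z)) (at z)"
    by (rule DERIV_mult'[OF Suc DERIV_cmult[OF D']])
  then show ?case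
    unfolding blaschke_prod_Suc[abs_def] by (simp add: algebra_simps)
qed

lemma norm_deriv_B:
  assumes "norm z = 1"
  shows "norm (deriv (B n) z) = (\<Sum>k<n. (norm (e k z))\<^sup>2)"
  unfolding DERIV_imp_deriv[OF has_field_derivative_B[OF assms]]
  using assms norm_B[OF assms, of n]
  by (simp add: norm_mult sum_nonneg del: of_real_sum of_real_power)

lemma norm_deriv_B_ge:
  assumes "norm z = 1"
  shows "norm (deriv (B n) z) \<ge> (\<Sum>j=1..n. 1 - norm (l j)) / 2"
proof -
  have "(1 - norm (l (Suc k))) / 2 \<le> (norm (e k z))\<^sup>2" for k
  proof -
    let ?r = "norm (l (Suc k))"
    have r: "0 \<le> ?r" "?r < 1"
      using l_Suc by auto
    have "norm (1 - cnj (l (Suc k)) * z) \<le> 1 + ?r"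
      using norm_triangle_ineq4[of 1 "cnj (l (Suc k)) * z"] assms by (simp add: norm_mult)
    then have le: "(norm (1 - cnj (l (Suc k)) * z))\<^sup>2 \<le> (1 + ?r)\<^sup>2"
      by (intro power_mono) auto
    have pos: "(norm (1 - cnj (l (Suc k)) * z))\<^sup>2 > 0"
      using one_minus_cnj_mult_nonzero[OF l_Suc assms] by simp
    have "(1 - ?r) / 2 \<le> (1 - ?r\<^sup>2) / (1 + ?r)\<^sup>2"
    proof -
      have "(1 - ?r\<^sup>2) / (1 + ?r)\<^sup>2 = (1 - ?r) / (1 + ?r)"
      proof -
        have "1 - ?r\<^sup>2 = (1 - ?r) * (1 + ?r)"
          by (simp add: power2_eq_square algebra_simps)
        then show ?thesis
          using r by (simp add: power2_eq_square)
      qed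
      also have "\<dots> \<ge> (1 - ?r) / 2"
        using r by (intro divide_left_mono mult_pos_pos add_pos_nonneg) auto
      finally show ?thesis .
    qed
    also have "\<dots> \<le> (1 - ?r\<^sup>2) / (norm (1 - cnj (l (Suc k)) * z))\<^sup>2"
      using le pos l_Suc_pos[of k] r
      by (intro divide_left_mono mult_pos_pos[OF zero_less_power]) (auto simp: add_pos_nonneg)
    finally show ?thesis
      by (simp add: norm_e_sq[OF assms])
  qed
  then have "(\<Sum>k<n. (1 - norm (l (Suc k))) / 2) \<le> norm (deriv (B n) z)"
    unfolding norm_deriv_B[OF assms] by (intro sum_mono)
  moreover have "(\<Sum>k<n. (1 - norm (l (Suc k))) / 2) = (\<Sum>j=1..n. 1 - norm (l j)) / 2"
    by (simp add: sum_divide_distrib sum.atLeast1_atMost_eq lessThan_atLeast0)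
  ultimately show ?thesis by simp
qed

end

section \<open>Concentration of the reproducing kernels and convergence of the traces\<close>

context blaschke_sequence
begin

definition kern :: "nat \<Rightarrow> complex \<Rightarrow> complex \<Rightarrow> complex" where
  "kern n \<zeta> = L2_subspace.kernel (e ` {..<n}) \<zeta>"

lemma kern_eq: "kern n \<zeta> z = (\<Sum>k<n. cnj (e k \<zeta>) * e k z)"
proof -
  interpret L2_subspace "model_space (B n)" "e ` {..<n}"
    by (rule L2_subspace_model_space)
  show ?thesis
    unfolding kern_def kernel_def by (subst sum.reindex) (auto intro: inj_on_subset[OF inj_e])
qed

lemma kern_in_model_space: "kern n \<zeta> \<in> model_space (B n)"
proof -
  interpret L2_subspace "model_space (B n)" "e ` {..<n}"
    by (rule L2_subspace_model_space)
  show ?thesis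
    unfolding kern_def by (rule kernel_in)
qed

lemma L2_norm_kern: 
  assumes "norm \<zeta> = 1"
  shows "(L2_norm (kern n \<zeta>))\<^sup>2 = norm (deriv (B n) \<zeta>)"
proof -
  interpret L2_subspace "model_space (B n)" "e ` {..<n}"
    by (rule L2_subspace_model_space)
  show ?thesis
    unfolding kern_def L2_norm_kernel norm_deriv_B[OF assms]
    by (subst sum.reindex) (auto intro: inj_on_subset[OF inj_e])
qed

text \<open>
  By the Christoffel--Darboux formula the left-hand side is \<open>\<bar>1 - cnj (B\<^sub>n(\<zeta>)) B\<^sub>n(z)\<bar>\<close>.
\<close>

lemma norm_kern_le:
  assumes "norm \<zeta> = 1" "norm z = 1"
  shows "dist z \<zeta> * norm (kern n \<zeta> z) \<le> 2"
proof -
  have "cnj \<zeta> * \<zeta> = 1"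
    using complex_norm_square[of \<zeta>] assms by (simp add: mult.commute)
  then have "1 - cnj \<zeta> * z = cnj \<zeta> * (\<zeta> - z)"
    by (simp add: right_diff_distrib)
  then have "norm (1 - cnj \<zeta> * z) = dist z \<zeta>"
    using assms by (simp add: norm_mult dist_norm norm_minus_commute)
  then have "dist z \<zeta> * norm (kern n \<zeta> z) = norm ((1 - cnj \<zeta> * z) * (\<Sum>k<n. cnj (e k \<zeta>) * e k z))"
    by (simp add: kern_eq norm_mult)
  also have "\<dots> = norm (1 - cnj (B n \<zeta>) * B n z)"
    by (simp only: sum_cnj_e_mult_e[OF assms])
  also have "\<dots> \<le> norm (1 :: complex) + norm (cnj (B n \<zeta>) * B n z)"
    by (rule norm_triangle_ineq4)
  also have "\<dots> = 2"
    using norm_B[OF assms(1)] norm_B[OF assms(2)] by (simp add: norm_mult)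
  finally show ?thesis .
qed

end

locale divergent_blaschke_sequence = blaschke_sequence +
  assumes divergent: "filterlim (\<lambda>n. \<Sum>j=1..n. 1 - norm (l j)) at_top sequentially"
begin

lemma eventually_L2_norm_kern_ge:
  "eventually (\<lambda>n. \<forall>\<zeta>. norm \<zeta> = 1 \<longrightarrow> C \<le> (L2_norm (kern n \<zeta>))\<^sup>2) sequentially"
proof -
  have "eventually (\<lambda>n. (\<Sum>j=1..n. 1 - norm (l j)) \<ge> 2 * C) sequentially"
    using divergent by (simp add: filterlim_at_top)
  then show ?thesis
  proof eventually_elim
    case (elim n)
    then show ?case
      using norm_deriv_B_ge[of _ n] L2_norm_kern[of _ n] by fastforce
  qed
qed

text \<open>
  Off a neighbourhood of \<open>\<zeta>\<close> the kernel at \<open>\<zeta>\<close> is bounded independently of \<open>n\<close>, whereas the square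
  \<open>\<bar>B\<^sub>n'(\<zeta>)\<bar>\<close> of its norm tends to infinity uniformly in \<open>\<zeta>\<close>. So the normalized kernels are an
  approximate identity.
\<close>

lemma kern_concentrates:
  assumes \<psi>: "continuous_on (sphere 0 1) \<psi>" and \<delta>: "\<delta> > 0"
  shows "eventually (\<lambda>n. \<forall>\<zeta>. norm \<zeta> = 1 \<longrightarrow>
    L2_norm (\<lambda>z. (\<psi> z - \<psi> \<zeta>) * kern n \<zeta> z) \<le> \<delta> * L2_norm (kern n \<zeta>)) sequentially"
proof -
  obtain M where M: "M \<ge> 1" "\<And>z. norm z = 1 \<Longrightarrow> norm (\<psi> z) \<le> M"
    using continuous_on_circle_bounded[OF \<psi>] by blast
  have "uniformly_continuous_on (sphere 0 1) \<psi>"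
    using \<psi> by (intro compact_uniformly_continuous) auto
  then obtain r where r: "r > 0"
    and unif: "\<And>z \<zeta>. norm z = 1 \<Longrightarrow> norm \<zeta> = 1 \<Longrightarrow> dist z \<zeta> < r \<Longrightarrow> dist (\<psi> z) (\<psi> \<zeta>) < \<delta> / 2"
    unfolding uniformly_continuous_on_def using \<delta> half_gt_zero[OF \<delta>] by (metis mem_sphere_0)
  \<comment> \<open>At distance at least \<open>r\<close> from \<open>\<zeta>\<close> the two factors are at most \<open>2 M\<close> and \<open>2 / r\<close>.\<close>
  define C where "C = 16 * M\<^sup>2 / r\<^sup>2"
  have pointwise: "(norm ((\<psi> z - \<psi> \<zeta>) * kern n \<zeta> z))\<^sup>2 \<le> \<delta>\<^sup>2 / 4 * (norm (kern n \<zeta> z))\<^sup>2 + C"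
    if z: "norm z = 1" and \<zeta>: "norm \<zeta> = 1" for z \<zeta> n
  proof (cases "dist z \<zeta> < r")
    case True
    have "(norm (\<psi> z - \<psi> \<zeta>))\<^sup>2 \<le> (\<delta> / 2)\<^sup>2"
      using unif[OF z \<zeta> True] by (intro power_mono) (auto simp: dist_norm)
    then have "(norm ((\<psi> z - \<psi> \<zeta>) * kern n \<zeta> z))\<^sup>2 \<le> \<delta>\<^sup>2 / 4 * (norm (kern n \<zeta> z))\<^sup>2"
      unfolding norm_mult power_mult_distrib by (intro mult_right_mono) (auto simp: power_divide)
    moreover have "C \<ge> 0"
      by (simp add: C_def)
    ultimately show ?thesis by simp
  next
    case False
    have "norm (\<psi> z - \<psi> \<zeta>) \<le> 2 * M"
      using norm_triangle_ineq4[of "\<psi> z" "\<psi> \<zeta>"] M(2)[OF z] M(2)[OF \<zeta>] by simp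
    moreover have "norm (kern n \<zeta> z) \<le> 2 / r"
    proof -
      have "r * norm (kern n \<zeta> z) \<le> dist z \<zeta> * norm (kern n \<zeta> z)"
        using False by (intro mult_right_mono) auto
      then show ?thesis
        using norm_kern_le[OF \<zeta> z, of n] r by (simp add: field_simps)
    qed
    ultimately have "norm ((\<psi> z - \<psi> \<zeta>) * kern n \<zeta> z) \<le> 2 * M * (2 / r)"
      unfolding norm_mult using M by (intro mult_mono) auto
    then have "(norm ((\<psi> z - \<psi> \<zeta>) * kern n \<zeta> z))\<^sup>2 \<le> (2 * M * (2 / r))\<^sup>2"
      by (intro power_mono) auto
    also have "\<dots> = C"
      by (simp add: C_def power_mult_distrib power_divide)
    finally show ?thesis
      using \<delta> by (simp add: add_increasing)
  qed
  have "eventually (\<lambda>n. \<forall>\<zeta>. norm \<zeta> = 1 \<longrightarrow> 2 * C / \<delta>\<^sup>2 \<le> (L2_norm (kern n \<zeta>))\<^sup>2) sequentially"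
    by (rule eventually_L2_norm_kern_ge)
  then show ?thesis
  proof (eventually_elim, intro allI impI)
    fix n \<zeta>
    assume *: "\<forall>\<zeta>. norm \<zeta> = 1 \<longrightarrow> 2 * C / \<delta>\<^sup>2 \<le> (L2_norm (kern n \<zeta>))\<^sup>2" and \<zeta>: "norm (\<zeta>::complex) = 1"
    let ?N = "(L2_norm (kern n \<zeta>))\<^sup>2"
    have k: "kern n \<zeta> \<in> L2"
      using kern_in_model_space model_space_L2 by blast
    have C: "C \<le> \<delta>\<^sup>2 / 2 * ?N"
    proof -
      have "2 * C / \<delta>\<^sup>2 \<le> ?N"
        using * \<zeta> by blast
      then show ?thesis
        using \<delta> by (simp add: field_simps)
    qed
    have diff: "(\<lambda>z. (\<psi> z - \<psi> \<zeta>) * kern n \<zeta> z) \<in> L2"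
      by (intro L2_mult_continuous k continuous_intros \<psi>)
    have "(L2_norm (\<lambda>z. (\<psi> z - \<psi> \<zeta>) * kern n \<zeta> z))\<^sup>2
        \<le> (\<integral>z. \<delta>\<^sup>2 / 4 * (norm (kern n \<zeta> z))\<^sup>2 + C \<partial>circle_measure)"
      unfolding L2_norm_sq
    proof (rule integral_mono[OF L2_sq_integrable[OF diff]])
      show "integrable circle_measure (\<lambda>z. \<delta>\<^sup>2 / 4 * (norm (kern n \<zeta> z))\<^sup>2 + C)"
        using L2_sq_integrable[OF k] by auto
    qed (use pointwise[OF _ \<zeta>, of _ n] in auto)
    also have "\<dots> = \<delta>\<^sup>2 / 4 * ?N + C"
      unfolding L2_norm_sq using L2_sq_integrable[OF k] by (subst Bochner_Integration.integral_add) auto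
    also have "\<dots> \<le> \<delta>\<^sup>2 / 4 * ?N + \<delta>\<^sup>2 / 2 * ?N"
      using C by simp
    also have "\<dots> \<le> \<delta>\<^sup>2 * ?N"
    proof -
      have "\<delta>\<^sup>2 * ?N \<ge> 0" by simp
      then show ?thesis by simp
    qed
    also have "\<dots> = (\<delta> * L2_norm (kern n \<zeta>))\<^sup>2"
      by (simp add: power_mult_distrib)
    finally show "L2_norm (\<lambda>z. (\<psi> z - \<psi> \<zeta>) * kern n \<zeta> z) \<le> \<delta> * L2_norm (kern n \<zeta>)"
      by (rule power2_le_imp_le) (use \<delta> in simp)
  qed
qed

text \<open>
  Since \<open>\<bar>B\<^sub>n'(\<zeta>)\<bar>\<close> is the square of the norm of the kernel, the symbol \<open>1 / \<bar>B\<^sub>n'\<bar>\<close> turns the trace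
  into an average over normalized kernels.
\<close>

lemma tendsto_trace_if_kern_approx:
  fixes G :: "complex \<Rightarrow> complex"
  assumes A: "\<And>n. adjoint_on (model_space (B n)) (A n) (A' n)"
    and G: "continuous_on (sphere 0 1) G"
    and approx: "\<And>\<epsilon>. \<epsilon> > 0 \<Longrightarrow> eventually (\<lambda>n. \<forall>\<zeta>. norm \<zeta> = 1 \<longrightarrow>
      norm (L2_inner (A n (kern n \<zeta>)) (kern n \<zeta>) - G \<zeta> * (L2_norm (kern n \<zeta>))\<^sup>2)
        \<le> \<epsilon> * (L2_norm (kern n \<zeta>))\<^sup>2) sequentially"
  shows "(\<lambda>n. L2_trace (model_space (B n))
      (trunc_toeplitz (B n) (\<lambda>\<zeta>. of_real (1 / norm (deriv (B n) \<zeta>))) \<circ> A n))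
    \<longlonglongrightarrow> (\<integral>\<zeta>. G \<zeta> \<partial>circle_measure)"
proof (rule tendstoI)
  fix \<epsilon> :: real assume "\<epsilon> > 0"
  then have "\<epsilon> / 2 > 0" by simp
  from approx[OF this] eventually_L2_norm_kern_ge[of 1]
  show "eventually (\<lambda>n. dist (L2_trace (model_space (B n))
      (trunc_toeplitz (B n) (\<lambda>\<zeta>. of_real (1 / norm (deriv (B n) \<zeta>))) \<circ> A n))
      (\<integral>\<zeta>. G \<zeta> \<partial>circle_measure) < \<epsilon>) sequentially"
  proof eventually_elim
    case (elim n)
    let ?w = "\<lambda>\<zeta>. complex_of_real (1 / norm (deriv (B n) \<zeta>))"
    interpret L2_subspace "model_space (B n)" "e ` {..<n}"
      by (rule L2_subspace_model_space)
    have pos: "norm (deriv (B n) \<zeta>) > 0" if "norm \<zeta> = 1" for \<zeta>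
      using elim(2) L2_norm_kern[OF that] that by (metis less_le_trans zero_less_one)
    have w: "continuous_on (sphere 0 1) ?w"
    proof -
      have "continuous_on (sphere 0 1) (\<lambda>\<zeta>. \<Sum>k<n. (norm (e k \<zeta>))\<^sup>2)"
        by (intro continuous_intros continuous_on_e)
      then have "continuous_on (sphere 0 1) (\<lambda>\<zeta>. norm (deriv (B n) \<zeta>))"
        by (rule continuous_on_eq) (simp add: norm_deriv_B)
      then show ?thesis
        using pos by (intro continuous_on_of_real continuous_on_divide continuous_on_const) auto
    qed
    let ?f = "\<lambda>\<zeta>. ?w \<zeta> * L2_inner (A n (kern n \<zeta>)) (kern n \<zeta>)"
    have f: "continuous_on (sphere 0 1) ?f"
      unfolding kern_def L2_inner_kernel[OF A]
      using continuous_on_e by (intro continuous_intros w) auto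
    have int: "integrable circle_measure ?f" "integrable circle_measure G"
      by (intro integrable_circle_continuous f G)+
    have trace: "L2_trace (model_space (B n)) (trunc_toeplitz (B n) ?w \<circ> A n) = (\<integral>\<zeta>. ?f \<zeta> \<partial>circle_measure)"
      using trace_compression_comp[OF A w] continuous_on_e
      unfolding kern_def trunc_toeplitz_def[abs_def] by auto
    have "norm ((\<integral>\<zeta>. ?f \<zeta> \<partial>circle_measure) - (\<integral>\<zeta>. G \<zeta> \<partial>circle_measure))
        = norm (\<integral>\<zeta>. ?f \<zeta> - G \<zeta> \<partial>circle_measure)"
      using int by (subst Bochner_Integration.integral_diff) auto
    also have "\<dots> \<le> (\<integral>\<zeta>. norm (?f \<zeta> - G \<zeta>) \<partial>circle_measure)"
      by (rule integral_norm_bound)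
    also have "\<dots> \<le> (\<integral>\<zeta>. \<epsilon> / 2 \<partial>circle_measure)"
    proof (rule integral_mono)
      show "integrable circle_measure (\<lambda>\<zeta>. norm (?f \<zeta> - G \<zeta>))"
        using int by auto
      fix \<zeta> :: complex assume "\<zeta> \<in> space circle_measure"
      then have \<zeta>: "norm \<zeta> = 1" by simp
      let ?N = "norm (deriv (B n) \<zeta>)" and ?I = "L2_inner (A n (kern n \<zeta>)) (kern n \<zeta>)"
      have N: "?N > 0"
        by (rule pos[OF \<zeta>])
      have "norm (?I - G \<zeta> * ?N) \<le> \<epsilon> / 2 * ?N"
        using elim(1) \<zeta> by (simp only: L2_norm_kern[OF \<zeta>, symmetric])
      moreover have "?f \<zeta> - G \<zeta> = (?I - G \<zeta> * ?N) / ?N"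
        using N by (simp add: diff_divide_distrib)
      ultimately show "norm (?f \<zeta> - G \<zeta>) \<le> \<epsilon> / 2"
        using N by (simp add: norm_divide divide_le_eq)
    qed simp
    also have "\<dots> < \<epsilon>"
      using \<open>\<epsilon> > 0\<close> by simp
    finally show ?case
      unfolding dist_norm trace .
  qed
qed

theorem trace_compression_power_tendsto:
  assumes \<psi>: "continuous_on (sphere 0 1) \<psi>"
  shows "(\<lambda>n. L2_trace (model_space (B n))
      (trunc_toeplitz (B n) (\<lambda>\<zeta>. of_real (1 / norm (deriv (B n) \<zeta>))) \<circ> trunc_toeplitz (B n) \<psi> ^^ p))
    \<longlonglongrightarrow> (\<integral>\<zeta>. \<psi> \<zeta> ^ p \<partial>circle_measure)"
proof (rule tendsto_trace_if_kern_approx)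
  show "continuous_on (sphere 0 1) (\<lambda>\<zeta>. \<psi> \<zeta> ^ p)"
    by (intro continuous_intros \<psi>)
next
  fix n
  interpret L2_subspace "model_space (B n)" "e ` {..<n}"
    by (rule L2_subspace_model_space)
  show "adjoint_on (model_space (B n)) (trunc_toeplitz (B n) \<psi> ^^ p)
      (trunc_toeplitz (B n) (\<lambda>z. cnj (\<psi> z)) ^^ p)"
    unfolding trunc_toeplitz_def[abs_def] by (intro adjoint_on_funpow adjoint_on_compression \<psi>)
next
  fix \<epsilon> :: real assume \<epsilon>: "\<epsilon> > 0"
  obtain M where M: "M \<ge> 1" "\<And>z. norm z = 1 \<Longrightarrow> norm (\<psi> z) \<le> M"
    using continuous_on_circle_bounded[OF \<psi>] by blast
  \<comment> \<open>The summand \<open>1\<close> keeps the denominator positive when \<open>p = 0\<close>.\<close>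
  define \<delta> where "\<delta> = \<epsilon> / (p * M ^ p + 1)"
  have pM: "p * M ^ p \<ge> 0"
    using M by simp
  then have \<delta>: "\<delta> > 0"
    using \<epsilon> by (simp add: \<delta>_def add_nonneg_pos)
  have "p * M ^ p * \<delta> = \<epsilon> * (p * M ^ p / (p * M ^ p + 1))"
    by (simp add: \<delta>_def)
  also have "\<dots> \<le> \<epsilon> * 1"
    using \<epsilon> pM by (intro mult_left_mono) auto
  finally have small: "p * M ^ p * \<delta> \<le> \<epsilon>" by simp
  show "eventually (\<lambda>n. \<forall>\<zeta>. norm \<zeta> = 1 \<longrightarrow>
      norm (L2_inner ((trunc_toeplitz (B n) \<psi> ^^ p) (kern n \<zeta>)) (kern n \<zeta>) - \<psi> \<zeta> ^ p * (L2_norm (kern n \<zeta>))\<^sup>2)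
        \<le> \<epsilon> * (L2_norm (kern n \<zeta>))\<^sup>2) sequentially"
    using kern_concentrates[OF \<psi> \<delta>]
  proof (eventually_elim, intro allI impI)
    fix n \<zeta>
    assume conc: "\<forall>\<zeta>. norm \<zeta> = 1 \<longrightarrow>
      L2_norm (\<lambda>z. (\<psi> z - \<psi> \<zeta>) * kern n \<zeta> z) \<le> \<delta> * L2_norm (kern n \<zeta>)" and \<zeta>: "norm (\<zeta>::complex) = 1"
    interpret L2_subspace "model_space (B n)" "e ` {..<n}"
      by (rule L2_subspace_model_space)
    have "norm (L2_inner ((trunc_toeplitz (B n) \<psi> ^^ p) (kern n \<zeta>)) (kern n \<zeta>) - \<psi> \<zeta> ^ p * (L2_norm (kern n \<zeta>))\<^sup>2)
        \<le> p * M ^ p * \<delta> * (L2_norm (kern n \<zeta>))\<^sup>2"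
      unfolding trunc_toeplitz_def[abs_def]
      by (rule compression_funpow_approx[OF \<psi> M(2) kern_in_model_space M(2)[OF \<zeta>] M(1)])
         (use conc \<zeta> \<delta> in auto)
    also have "\<dots> \<le> \<epsilon> * (L2_norm (kern n \<zeta>))\<^sup>2"
      using small by (intro mult_right_mono) auto
    finally show "norm (L2_inner ((trunc_toeplitz (B n) \<psi> ^^ p) (kern n \<zeta>)) (kern n \<zeta>)
        - \<psi> \<zeta> ^ p * (L2_norm (kern n \<zeta>))\<^sup>2) \<le> \<epsilon> * (L2_norm (kern n \<zeta>))\<^sup>2" .
  qed
qed

lemma compression_eigenbasis_exists:
  assumes "continuous_on (sphere 0 1) \<psi>" "\<And>z. norm z = 1 \<Longrightarrow> \<psi> z \<in> \<real>"
  obtains F \<mu> where "L2_compression_eigenbasis (model_space (B n)) F \<psi> \<mu>"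
proof -
  interpret L2_subspace "model_space (B n)" "e ` {..<n}"
    by (rule L2_subspace_model_space)
  obtain F \<mu> where F: "L2_orthonormal_basis (model_space (B n)) F"
    and \<mu>: "\<And>f. f \<in> F \<Longrightarrow> AE z in circle_measure. compression \<psi> f z = complex_of_real (\<mu> f) * f z"
    using orthonormal_eigenbasis[OF adjoint_on_compression_real[OF assms]] by blast
  have "L2_compression_eigenbasis (model_space (B n)) F \<psi> \<mu>"
    by unfold_locales (use K_L2 K_zero K_add K_scale F \<mu> assms in auto)
  then show thesis
    using that by blast
qed

theorem trace_compression_fun_calc_tendsto:
  fixes g :: "real \<Rightarrow> complex"
  assumes \<psi>: "continuous_on (sphere 0 1) \<psi>" and real: "\<And>z. norm z = 1 \<Longrightarrow> \<psi> z \<in> \<real>"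
    and bounds: "\<And>z. norm z = 1 \<Longrightarrow> Re (\<psi> z) \<in> {x..y}" and g: "continuous_on {x..y} g"
  shows "(\<lambda>n. L2_trace (model_space (B n))
      (trunc_toeplitz (B n) (\<lambda>\<zeta>. of_real (1 / norm (deriv (B n) \<zeta>))) \<circ>
       L2_fun_calc (model_space (B n)) (trunc_toeplitz (B n) \<psi>) g))
    \<longlonglongrightarrow> (\<integral>\<zeta>. g (Re (\<psi> \<zeta>)) \<partial>circle_measure)"
proof (rule tendsto_trace_if_kern_approx)
  show "continuous_on (sphere 0 1) (\<lambda>\<zeta>. g (Re (\<psi> \<zeta>)))"
    by (rule continuous_on_compose2[OF g]) (use bounds \<psi> in \<open>auto intro!: continuous_intros\<close>)
next
  fix n
  obtain F \<mu> where "L2_compression_eigenbasis (model_space (B n)) F \<psi> \<mu>"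
    using compression_eigenbasis_exists[OF \<psi> real] .
  then interpret L2_compression_eigenbasis "model_space (B n)" F \<psi> \<mu> .
  show "adjoint_on (model_space (B n)) (L2_fun_calc (model_space (B n)) (trunc_toeplitz (B n) \<psi>) g)
      (L2_fun_calc (model_space (B n)) (trunc_toeplitz (B n) \<psi>) (\<lambda>s. cnj (g s)))"
    unfolding trunc_toeplitz_def[abs_def] by (rule adjoint_on_fun_calc)
next
  fix \<epsilon> :: real assume \<epsilon>: "\<epsilon> > 0"
  have "compact (g ` {x..y})"
    by (intro compact_continuous_image g) auto
  then obtain G0 where G0: "\<And>s. s \<in> {x..y} \<Longrightarrow> norm (g s) \<le> G0"
    using compact_imp_bounded bounded_iff by (metis imageI)
  define G where "G = max 1 G0"
  have G: "G \<ge> 1" "\<And>s. s \<in> {x..y} \<Longrightarrow> norm (g s) \<le> G"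
    using G0 by (auto simp: G_def le_max_iff_disj)
  have "uniformly_continuous_on {x..y} g"
    by (intro compact_uniformly_continuous g) auto
  then obtain d where d: "d > 0"
    and unif: "\<And>s c. s \<in> {x..y} \<Longrightarrow> c \<in> {x..y} \<Longrightarrow> dist s c < d \<Longrightarrow> dist (g s) (g c) < \<epsilon> / 2"
    unfolding uniformly_continuous_on_def using half_gt_zero[OF \<epsilon>] by metis
  \<comment> \<open>Chosen so that the tail term \<open>2 G \<delta>\<^sup>2 / d\<^sup>2\<close> in Chebyshev's inequality is \<open>\<epsilon> / 2\<close>.\<close>
  define \<delta> where "\<delta> = d * sqrt (\<epsilon> / (4 * G))"
  have \<delta>: "\<delta> > 0"
    using d \<epsilon> G by (simp add: \<delta>_def)
  have eq: "\<epsilon> / 2 + 2 * G * \<delta>\<^sup>2 / d\<^sup>2 = \<epsilon>"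
    using d \<epsilon> G by (simp add: \<delta>_def power_mult_distrib)
  show "eventually (\<lambda>n. \<forall>\<zeta>. norm \<zeta> = 1 \<longrightarrow>
      norm (L2_inner (L2_fun_calc (model_space (B n)) (trunc_toeplitz (B n) \<psi>) g (kern n \<zeta>)) (kern n \<zeta>)
        - g (Re (\<psi> \<zeta>)) * (L2_norm (kern n \<zeta>))\<^sup>2) \<le> \<epsilon> * (L2_norm (kern n \<zeta>))\<^sup>2) sequentially"
    using kern_concentrates[OF \<psi> \<delta>]
  proof (eventually_elim, intro allI impI)
    fix n \<zeta>
    assume conc: "\<forall>\<zeta>. norm \<zeta> = 1 \<longrightarrow>
      L2_norm (\<lambda>z. (\<psi> z - \<psi> \<zeta>) * kern n \<zeta> z) \<le> \<delta> * L2_norm (kern n \<zeta>)" and \<zeta>: "norm (\<zeta>::complex) = 1"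
    obtain F \<mu> where "L2_compression_eigenbasis (model_space (B n)) F \<psi> \<mu>"
      using compression_eigenbasis_exists[OF \<psi> real] .
    then interpret L2_compression_eigenbasis "model_space (B n)" F \<psi> \<mu> .
    have \<psi>\<zeta>: "of_real (Re (\<psi> \<zeta>)) = \<psi> \<zeta>"
      using real[OF \<zeta>] by simp
    have "norm (L2_inner (L2_fun_calc (model_space (B n)) (trunc_toeplitz (B n) \<psi>) g (kern n \<zeta>)) (kern n \<zeta>)
        - g (Re (\<psi> \<zeta>)) * (L2_norm (kern n \<zeta>))\<^sup>2)
        \<le> (\<epsilon> / 2 + 2 * G * \<delta>\<^sup>2 / d\<^sup>2) * (L2_norm (kern n \<zeta>))\<^sup>2"
      unfolding trunc_toeplitz_def[abs_def]
    proof (rule fun_calc_approx[OF kern_in_model_space bounds bounds[OF \<zeta>] G(2)])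
      show "norm (g s - g (Re (\<psi> \<zeta>))) \<le> \<epsilon> / 2" if "s \<in> {x..y}" "\<bar>s - Re (\<psi> \<zeta>)\<bar> < d" for s
        using unif[OF that(1) bounds[OF \<zeta>]] that(2) by (simp add: dist_norm less_imp_le)
      show "L2_norm (\<lambda>z. (\<psi> z - of_real (Re (\<psi> \<zeta>))) * kern n \<zeta> z) \<le> \<delta> * L2_norm (kern n \<zeta>)"
        unfolding \<psi>\<zeta> using conc \<zeta> by blast
    qed (use d \<epsilon> G \<delta> in auto)
    then show "norm (L2_inner (L2_fun_calc (model_space (B n)) (trunc_toeplitz (B n) \<psi>) g (kern n \<zeta>)) (kern n \<zeta>)
        - g (Re (\<psi> \<zeta>)) * (L2_norm (kern n \<zeta>))\<^sup>2) \<le> \<epsilon> * (L2_norm (kern n \<zeta>))\<^sup>2"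
      unfolding eq .
  qed
qed

end

theorem theorem6p1:
  fixes l :: "nat \<Rightarrow> complex" and \<psi> :: "complex \<Rightarrow> complex" and p :: nat
    and B :: "nat \<Rightarrow> complex \<Rightarrow> complex"
    and w :: "nat \<Rightarrow> complex \<Rightarrow> complex"
  assumes "\<And>j. j \<ge> 1 \<Longrightarrow> l j \<in> ball 0 1"
    and "filterlim (\<lambda>n. \<Sum>j=1..n. 1 - norm (l j)) at_top sequentially"
    and "continuous_on (sphere 0 1) \<psi>"
  defines "B \<equiv> blaschke_prod l"
    and "w \<equiv> \<lambda>n \<zeta>. of_real (1 / norm (deriv (B n) \<zeta>))"
  shows
    "(\<lambda>n. L2_trace (model_space (B n))
            (trunc_toeplitz (B n) (w n) \<circ> trunc_toeplitz (B n) \<psi> ^^ p))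
        \<longlonglongrightarrow> (\<integral>\<zeta>. \<psi> \<zeta> ^ p \<partial>circle_measure)
     \<and> ((\<forall>\<zeta>\<in>sphere 0 1. \<psi> \<zeta> \<in> \<real>) \<longrightarrow>
        (\<forall>g :: real \<Rightarrow> complex.
          continuous_on {INF \<zeta>\<in>sphere 0 1. Re (\<psi> \<zeta>)..SUP \<zeta>\<in>sphere 0 1. Re (\<psi> \<zeta>)} g \<longrightarrow>
          (\<lambda>n. L2_trace (model_space (B n))
                 (trunc_toeplitz (B n) (w n) \<circ>
                  L2_fun_calc (model_space (B n)) (trunc_toeplitz (B n) \<psi>) g))
            \<longlonglongrightarrow> (\<integral>\<zeta>. g (Re (\<psi> \<zeta>)) \<partial>circle_measure)))"
proof -
  interpret divergent_blaschke_sequence l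
    using assms(1,2) by unfold_locales auto
  have "bounded ((\<lambda>\<zeta>. Re (\<psi> \<zeta>)) ` sphere 0 1)"
    by (intro compact_imp_bounded compact_continuous_image continuous_intros assms(3)) auto
  then have bounds: "Re (\<psi> z) \<in> {INF \<zeta>\<in>sphere 0 1. Re (\<psi> \<zeta>)..SUP \<zeta>\<in>sphere 0 1. Re (\<psi> \<zeta>)}" if "norm z = 1" for z
    using that by (auto intro!: cINF_lower cSUP_upper bounded_imp_bdd_above bounded_imp_bdd_below)
  show ?thesis
    unfolding B_def w_def
    using trace_compression_power_tendsto[OF assms(3)]
      trace_compression_fun_calc_tendsto[OF assms(3) _ bounds] by auto
qed

end
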